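(* Let $\mathcal C$ be a finitely complete regular category. There is a bijection between the epireflective subcategories of $\mathcal C$ and the effective closure operators on effective equivalence relations in $\mathcal C$.
   Context: An epireflective subcategory $\mathcal L$ of $\mathcal C$ is a full replete reflective subcategory, with inclusion $\iota\colon\mathcal L\to\mathcal C$ and left adjoint $\lambda\colon\mathcal C\to\mathcal L$, such that every component $\eta_A\colon A\to\iota\lambda(A)$ of the unit of the adjunction is a regular epimorphism. An equivalence relation $S$ on an object $X$ is effective if it is the kernel pair of some morphism with domain $X$. Relations on $X$ are regarded as subobjects of $X\times X$, and equality and inclusion are those of subobjects. For an arrow $f\colon Y\to X$ and an equivalence relation $S$ on $X$, $f^{-1}(S)$ is the inverse image of $S$ along $f$, i.e. the pullback of $S\to X\times X$ along $f\times f\colon Y\times Y\to X\times X$. An idempotent closure operator on effective equivalence relations in $\mathcal C$ assigns to every effective equivalence relation $S$ on any object $X$ an effective equivalence relation $\overline S$ on $X$, called the closure of $S$, such that, for all effective equivalence relations $S,T$ on $X$ and every arrow $f\colon Y\to X$ in $\mathcal C$: (1) $S\subseteq\overline S$; (2) $S\subseteq T$ implies $\overline S\subseteq\overline T$; (3) $\overline{f^{-1}(S)}\subseteq f^{-1}(\overline S)$; (4) $\overline{\overline S}=\overline S$. It is called an effective closure operator if it also satisfies: (5) for every regular epimorphism $f\colon Y\to X$ and every effective equivalence relation $S$ on $X$, $\overline{f^{-1}(S)}=f^{-1}(\overline S)$. *)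

theory Defs
  imports "HOL-Library.FuncSet"
begin

section \<open>Categories and functors\<close>

record ('o, 'a) category =
  Ob :: "'o set"
  Arr :: "'a set"
  Dom :: "'a \<Rightarrow> 'o"
  Cod :: "'a \<Rightarrow> 'o"
  Idn :: "'o \<Rightarrow> 'a"
  Comp :: "['a, 'a] \<Rightarrow> 'a"  (infixl "\<cdot>\<index>" 70)

definition hom :: "('o, 'a) category \<Rightarrow> 'o \<Rightarrow> 'o \<Rightarrow> 'a set" where
  "hom C A B = {f \<in> Arr C. Dom C f = A \<and> Cod C f = B}"

locale category =
  fixes C :: "('o, 'a) category" (structure)
  assumes Dom_in_Ob: "f \<in> Arr C \<Longrightarrow> Dom C f \<in> Ob C"
    and Cod_in_Ob: "f \<in> Arr C \<Longrightarrow> Cod C f \<in> Ob C"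
    and Idn_in_hom: "A \<in> Ob C \<Longrightarrow> Idn C A \<in> hom C A A"
    and Comp_in_hom: "f \<in> hom C A B \<Longrightarrow> g \<in> hom C B D \<Longrightarrow> g \<cdot> f \<in> hom C A D"
    and Idn_left: "f \<in> hom C A B \<Longrightarrow> Idn C B \<cdot> f = f"
    and Idn_right: "f \<in> hom C A B \<Longrightarrow> f \<cdot> Idn C A = f"
    and Comp_assoc: "f \<in> hom C A B \<Longrightarrow> g \<in> hom C B D \<Longrightarrow> h \<in> hom C D E \<Longrightarrow>
      (h \<cdot> g) \<cdot> f = h \<cdot> (g \<cdot> f)"

record ('o, 'a, 'p, 'b) fnctr =
  on_ob :: "'o \<Rightarrow> 'p"
  on_arr :: "'a \<Rightarrow> 'b"

definition is_functor ::
    "('o, 'a) category \<Rightarrow> ('p, 'b) category \<Rightarrow> ('o, 'a, 'p, 'b) fnctr \<Rightarrow> bool" where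
  "is_functor C D F \<longleftrightarrow>
     (\<forall>A\<in>Ob C. on_ob F A \<in> Ob D) \<and>
     (\<forall>A\<in>Ob C. \<forall>B\<in>Ob C. \<forall>f\<in>hom C A B. on_arr F f \<in> hom D (on_ob F A) (on_ob F B)) \<and>
     (\<forall>A\<in>Ob C. on_arr F (Idn C A) = Idn D (on_ob F A)) \<and>
     (\<forall>f\<in>Arr C. \<forall>g\<in>Arr C. Cod C f = Dom C g \<longrightarrow>
        on_arr F (g \<cdot>\<^bsub>C\<^esub> f) = on_arr F g \<cdot>\<^bsub>D\<^esub> on_arr F f)"

definition id_functor :: "('o, 'a, 'o, 'a) fnctr" where
  "id_functor = \<lparr>on_ob = \<lambda>A. A, on_arr = \<lambda>f. f\<rparr>"

definition comp_functor ::
    "('p, 'b, 'q, 'c) fnctr \<Rightarrow> ('o, 'a, 'p, 'b) fnctr \<Rightarrow> ('o, 'a, 'q, 'c) fnctr" where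
  "comp_functor G F = \<lparr>on_ob = on_ob G \<circ> on_ob F, on_arr = on_arr G \<circ> on_arr F\<rparr>"

definition is_nat_trans :: "('o, 'a) category \<Rightarrow> ('p, 'b) category \<Rightarrow>
    ('o, 'a, 'p, 'b) fnctr \<Rightarrow> ('o, 'a, 'p, 'b) fnctr \<Rightarrow> ('o \<Rightarrow> 'b) \<Rightarrow> bool" where
  "is_nat_trans C D F G \<eta> \<longleftrightarrow>
     (\<forall>A\<in>Ob C. \<eta> A \<in> hom D (on_ob F A) (on_ob G A)) \<and>
     (\<forall>A\<in>Ob C. \<forall>B\<in>Ob C. \<forall>f\<in>hom C A B. \<eta> B \<cdot>\<^bsub>D\<^esub> on_arr F f = on_arr G f \<cdot>\<^bsub>D\<^esub> \<eta> A)"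

text \<open>An adjunction between \<open>F : C \<rightarrow> D\<close> and \<open>G : D \<rightarrow> C\<close> is given by its unit: a natural
  transformation all of whose components are universal arrows to \<open>G\<close>.\<close>

definition is_left_adjoint :: "('o, 'a) category \<Rightarrow> ('p, 'b) category \<Rightarrow>
    ('o, 'a, 'p, 'b) fnctr \<Rightarrow> ('p, 'b, 'o, 'a) fnctr \<Rightarrow> ('o \<Rightarrow> 'a) \<Rightarrow> bool" where
  "is_left_adjoint C D F G \<eta> \<longleftrightarrow>
     is_functor C D F \<and> is_functor D C G \<and>
     is_nat_trans C C id_functor (comp_functor G F) \<eta> \<and>
     (\<forall>A\<in>Ob C. \<forall>B\<in>Ob D. \<forall>f\<in>hom C A (on_ob G B).
        \<exists>!g. g \<in> hom D (on_ob F A) B \<and> on_arr G g \<cdot>\<^bsub>C\<^esub> \<eta> A = f)"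


section \<open>Monomorphisms, isomorphisms, regular epimorphisms\<close>

definition is_mono :: "('o, 'a) category \<Rightarrow> 'a \<Rightarrow> bool" where
  "is_mono C m \<longleftrightarrow> m \<in> Arr C \<and>
     (\<forall>A\<in>Ob C. \<forall>u\<in>hom C A (Dom C m). \<forall>v\<in>hom C A (Dom C m).
        m \<cdot>\<^bsub>C\<^esub> u = m \<cdot>\<^bsub>C\<^esub> v \<longrightarrow> u = v)"

definition is_iso :: "('o, 'a) category \<Rightarrow> 'a \<Rightarrow> bool" where
  "is_iso C f \<longleftrightarrow> f \<in> Arr C \<and>
     (\<exists>g\<in>hom C (Cod C f) (Dom C f).
        g \<cdot>\<^bsub>C\<^esub> f = Idn C (Dom C f) \<and> f \<cdot>\<^bsub>C\<^esub> g = Idn C (Cod C f))"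

definition is_coequalizer :: "('o, 'a) category \<Rightarrow> 'a \<Rightarrow> 'a \<Rightarrow> 'a \<Rightarrow> bool" where
  "is_coequalizer C f g q \<longleftrightarrow>
     f \<in> Arr C \<and> g \<in> Arr C \<and> q \<in> Arr C \<and>
     Dom C f = Dom C g \<and> Cod C f = Cod C g \<and> Dom C q = Cod C f \<and>
     q \<cdot>\<^bsub>C\<^esub> f = q \<cdot>\<^bsub>C\<^esub> g \<and>
     (\<forall>h\<in>Arr C. Dom C h = Cod C f \<and> h \<cdot>\<^bsub>C\<^esub> f = h \<cdot>\<^bsub>C\<^esub> g \<longrightarrow>
        (\<exists>!k. k \<in> hom C (Cod C q) (Cod C h) \<and> k \<cdot>\<^bsub>C\<^esub> q = h))"

definition is_regular_epi :: "('o, 'a) category \<Rightarrow> 'a \<Rightarrow> bool" where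
  "is_regular_epi C q \<longleftrightarrow> (\<exists>f g. is_coequalizer C f g q)"


section \<open>Finite limits and regularity\<close>

definition is_cone :: "('i, 'j) category \<Rightarrow> ('o, 'a) category \<Rightarrow> ('i, 'j, 'o, 'a) fnctr \<Rightarrow>
    'o \<Rightarrow> ('i \<Rightarrow> 'a) \<Rightarrow> bool" where
  "is_cone J C F L \<pi> \<longleftrightarrow> L \<in> Ob C \<and>
     (\<forall>i\<in>Ob J. \<pi> i \<in> hom C L (on_ob F i)) \<and>
     (\<forall>j\<in>Arr J. on_arr F j \<cdot>\<^bsub>C\<^esub> \<pi> (Dom J j) = \<pi> (Cod J j))"

definition is_limit :: "('i, 'j) category \<Rightarrow> ('o, 'a) category \<Rightarrow> ('i, 'j, 'o, 'a) fnctr \<Rightarrow>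
    'o \<Rightarrow> ('i \<Rightarrow> 'a) \<Rightarrow> bool" where
  "is_limit J C F L \<pi> \<longleftrightarrow> is_cone J C F L \<pi> \<and>
     (\<forall>M \<rho>. is_cone J C F M \<rho> \<longrightarrow>
        (\<exists>!u. u \<in> hom C M L \<and> (\<forall>i\<in>Ob J. \<pi> i \<cdot>\<^bsub>C\<^esub> u = \<rho> i)))"

text \<open>Every finite category is isomorphic to one whose objects and arrows are natural numbers,
  so quantifying over the latter covers all finite diagrams.\<close>

definition finitely_complete :: "('o, 'a) category \<Rightarrow> bool" where
  "finitely_complete C \<longleftrightarrow>
     (\<forall>(J :: (nat, nat) category) F.
        category J \<and> finite (Ob J) \<and> finite (Arr J) \<and> is_functor J C F \<longrightarrow>
        (\<exists>L \<pi>. is_limit J C F L \<pi>))"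

text \<open>\<open>is_pullback C f g p q\<close>: the span \<open>(p, q)\<close> is a pullback of the cospan \<open>(f, g)\<close>,
  with \<open>f p = g q\<close>; in particular \<open>q\<close> is a pullback of \<open>f\<close> along \<open>g\<close>.\<close>

definition is_pullback :: "('o, 'a) category \<Rightarrow> 'a \<Rightarrow> 'a \<Rightarrow> 'a \<Rightarrow> 'a \<Rightarrow> bool" where
  "is_pullback C f g p q \<longleftrightarrow>
     f \<in> Arr C \<and> g \<in> Arr C \<and> p \<in> Arr C \<and> q \<in> Arr C \<and>
     Cod C f = Cod C g \<and> Dom C p = Dom C q \<and> Cod C p = Dom C f \<and> Cod C q = Dom C g \<and>
     f \<cdot>\<^bsub>C\<^esub> p = g \<cdot>\<^bsub>C\<^esub> q \<and>
     (\<forall>A\<in>Ob C. \<forall>a\<in>hom C A (Dom C f). \<forall>b\<in>hom C A (Dom C g).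
        f \<cdot>\<^bsub>C\<^esub> a = g \<cdot>\<^bsub>C\<^esub> b \<longrightarrow>
        (\<exists>!u. u \<in> hom C A (Dom C p) \<and> p \<cdot>\<^bsub>C\<^esub> u = a \<and> q \<cdot>\<^bsub>C\<^esub> u = b))"

definition regular :: "('o, 'a) category \<Rightarrow> bool" where
  "regular C \<longleftrightarrow>
     (\<forall>f\<in>Arr C. \<exists>p q. is_pullback C f f p q) \<and>
     (\<forall>f p q. is_pullback C f f p q \<longrightarrow> (\<exists>e. is_coequalizer C p q e)) \<and>
     (\<forall>f g. is_regular_epi C f \<and> g \<in> Arr C \<and> Cod C f = Cod C g \<longrightarrow>
        (\<exists>p q. is_pullback C f g p q)) \<and>
     (\<forall>f g p q. is_pullback C f g p q \<and> is_regular_epi C f \<longrightarrow> is_regular_epi C q)"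


section \<open>Subobjects and relations\<close>

definition factors :: "('o, 'a) category \<Rightarrow> 'a \<Rightarrow> 'a \<Rightarrow> bool" where
  "factors C u m \<longleftrightarrow> (\<exists>k\<in>hom C (Dom C u) (Dom C m). m \<cdot>\<^bsub>C\<^esub> k = u)"

definition monos_into :: "('o, 'a) category \<Rightarrow> 'o \<Rightarrow> 'a set" where
  "monos_into C X = {m. is_mono C m \<and> Cod C m = X}"

text \<open>A subobject is an equivalence class of monomorphisms with a common codomain.\<close>

definition Sub :: "('o, 'a) category \<Rightarrow> 'o \<Rightarrow> 'a set set" where
  "Sub C X = monos_into C X //
     {(m, n). m \<in> monos_into C X \<and> n \<in> monos_into C X \<and> factors C m n \<and> factors C n m}"

definition sub_le :: "('o, 'a) category \<Rightarrow> 'a set \<Rightarrow> 'a set \<Rightarrow> bool" where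
  "sub_le C S T \<longleftrightarrow> (\<exists>m\<in>S. \<exists>n\<in>T. factors C m n)"

text \<open>The class of all pullbacks along \<open>h\<close> of representatives of the subobject \<open>T\<close>
  of the codomain of \<open>h\<close>.\<close>

definition pullback_sub :: "('o, 'a) category \<Rightarrow> 'a \<Rightarrow> 'a set \<Rightarrow> 'a set" where
  "pullback_sub C h T = {m. \<exists>n\<in>T. \<exists>k. is_pullback C n h k m}"

definition is_product :: "('o, 'a) category \<Rightarrow> 'o \<Rightarrow> 'o \<Rightarrow> 'o \<times> 'a \<times> 'a \<Rightarrow> bool" where
  "is_product C X Y = (\<lambda>(P, p, q).
     p \<in> hom C P X \<and> q \<in> hom C P Y \<and>
     (\<forall>A\<in>Ob C. \<forall>a\<in>hom C A X. \<forall>b\<in>hom C A Y.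
        \<exists>!u. u \<in> hom C A P \<and> p \<cdot>\<^bsub>C\<^esub> u = a \<and> q \<cdot>\<^bsub>C\<^esub> u = b))"

text \<open>A chosen product \<open>X \<times> X\<close>, with its projections.\<close>

definition square :: "('o, 'a) category \<Rightarrow> 'o \<Rightarrow> 'o \<times> 'a \<times> 'a" where
  "square C X = (SOME P. is_product C X X P)"

definition sq :: "('o, 'a) category \<Rightarrow> 'o \<Rightarrow> 'o" where
  "sq C X = fst (square C X)"

definition pr1 :: "('o, 'a) category \<Rightarrow> 'o \<Rightarrow> 'a" where
  "pr1 C X = fst (snd (square C X))"

definition pr2 :: "('o, 'a) category \<Rightarrow> 'o \<Rightarrow> 'a" where
  "pr2 C X = snd (snd (square C X))"

definition pairing :: "('o, 'a) category \<Rightarrow> 'a \<Rightarrow> 'a \<Rightarrow> 'a" where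
  "pairing C a b = (THE u. u \<in> hom C (Dom C a) (sq C (Cod C a)) \<and>
     pr1 C (Cod C a) \<cdot>\<^bsub>C\<^esub> u = a \<and> pr2 C (Cod C a) \<cdot>\<^bsub>C\<^esub> u = b)"

definition sq_arr :: "('o, 'a) category \<Rightarrow> 'a \<Rightarrow> 'a" where
  "sq_arr C f = pairing C (f \<cdot>\<^bsub>C\<^esub> pr1 C (Dom C f)) (f \<cdot>\<^bsub>C\<^esub> pr2 C (Dom C f))"

text \<open>A relation on \<open>X\<close> is a subobject of \<open>X \<times> X\<close>; it is an equivalence relation if it induces
  an equivalence relation on the set of generalized elements \<open>A \<rightarrow> X\<close> for every \<open>A\<close>.\<close>

definition is_equivalence_relation :: "('o, 'a) category \<Rightarrow> 'o \<Rightarrow> 'a set \<Rightarrow> bool" where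
  "is_equivalence_relation C X S \<longleftrightarrow> S \<in> Sub C (sq C X) \<and>
     (\<forall>A\<in>Ob C. equiv (hom C A X)
        {(x, y). x \<in> hom C A X \<and> y \<in> hom C A X \<and> (\<exists>m\<in>S. factors C (pairing C x y) m)})"

text \<open>The kernel pair of \<open>f\<close> as a subobject of \<open>X \<times> X\<close>, where \<open>X\<close> is the domain of \<open>f\<close>.\<close>

definition kernel_pair :: "('o, 'a) category \<Rightarrow> 'a \<Rightarrow> 'a set" where
  "kernel_pair C f = {m \<in> Arr C. Cod C m = sq C (Dom C f) \<and>
     is_pullback C f f (pr1 C (Dom C f) \<cdot>\<^bsub>C\<^esub> m) (pr2 C (Dom C f) \<cdot>\<^bsub>C\<^esub> m)}"

definition EffEq :: "('o, 'a) category \<Rightarrow> 'o \<Rightarrow> 'a set set" where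
  "EffEq C X = {S. is_equivalence_relation C X S \<and>
     (\<exists>f\<in>Arr C. Dom C f = X \<and> S = kernel_pair C f)}"

definition inv_image_rel :: "('o, 'a) category \<Rightarrow> 'a \<Rightarrow> 'a set \<Rightarrow> 'a set" where
  "inv_image_rel C f S = pullback_sub C (sq_arr C f) S"


section \<open>Closure operators on effective equivalence relations\<close>

text \<open>Operators are extensional functions, so that two of them are equal iff they agree
  on all effective equivalence relations.\<close>

definition idempotent_closure_operator ::
    "('o, 'a) category \<Rightarrow> ('o \<Rightarrow> 'a set \<Rightarrow> 'a set) \<Rightarrow> bool" where
  "idempotent_closure_operator C cl \<longleftrightarrow>
     cl \<in> (\<Pi>\<^sub>E X\<in>Ob C. EffEq C X \<rightarrow>\<^sub>E EffEq C X) \<and>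
     (\<forall>X\<in>Ob C. \<forall>S\<in>EffEq C X. sub_le C S (cl X S)) \<and>
     (\<forall>X\<in>Ob C. \<forall>S\<in>EffEq C X. \<forall>T\<in>EffEq C X.
        sub_le C S T \<longrightarrow> sub_le C (cl X S) (cl X T)) \<and>
     (\<forall>X\<in>Ob C. \<forall>Y\<in>Ob C. \<forall>f\<in>hom C Y X. \<forall>S\<in>EffEq C X.
        sub_le C (cl Y (inv_image_rel C f S)) (inv_image_rel C f (cl X S))) \<and>
     (\<forall>X\<in>Ob C. \<forall>S\<in>EffEq C X. cl X (cl X S) = cl X S)"

definition effective_closure_operators ::
    "('o, 'a) category \<Rightarrow> ('o \<Rightarrow> 'a set \<Rightarrow> 'a set) set" where
  "effective_closure_operators C = {cl. idempotent_closure_operator C cl \<and>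
     (\<forall>X\<in>Ob C. \<forall>Y\<in>Ob C. \<forall>f\<in>hom C Y X. \<forall>S\<in>EffEq C X. is_regular_epi C f \<longrightarrow>
        cl Y (inv_image_rel C f S) = inv_image_rel C f (cl X S))}"


section \<open>Epireflective subcategories\<close>

text \<open>A subcategory is given by its sets of objects and arrows, the structure being inherited.\<close>

definition subcat :: "('o, 'a) category \<Rightarrow> 'o set \<times> 'a set \<Rightarrow> ('o, 'a) category" where
  "subcat C L = C\<lparr>Ob := fst L, Arr := snd L\<rparr>"

definition is_subcategory :: "('o, 'a) category \<Rightarrow> 'o set \<times> 'a set \<Rightarrow> bool" where
  "is_subcategory C L \<longleftrightarrow> fst L \<subseteq> Ob C \<and> snd L \<subseteq> Arr C \<and> category (subcat C L)"

definition is_full :: "('o, 'a) category \<Rightarrow> 'o set \<times> 'a set \<Rightarrow> bool" where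
  "is_full C L \<longleftrightarrow> (\<forall>A\<in>fst L. \<forall>B\<in>fst L. hom C A B \<subseteq> snd L)"

definition is_replete :: "('o, 'a) category \<Rightarrow> 'o set \<times> 'a set \<Rightarrow> bool" where
  "is_replete C L \<longleftrightarrow>
     (\<forall>f. is_iso C f \<and> Dom C f \<in> fst L \<longrightarrow> Cod C f \<in> fst L \<and> f \<in> snd L)"

text \<open>The inclusion functor of a subcategory is \<open>id_functor\<close>, which has the identity maps
  as its action on objects and arrows.\<close>

definition epireflective_subcategories :: "('o, 'a) category \<Rightarrow> ('o set \<times> 'a set) set" where
  "epireflective_subcategories C =
     {L. is_subcategory C L \<and> is_full C L \<and> is_replete C L \<and>
         (\<exists>R \<eta>. is_left_adjoint C (subcat C L) R id_functor \<eta> \<and>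
                (\<forall>A\<in>Ob C. is_regular_epi C (\<eta> A)))}"

end

theory Submission
  imports Defs
begin

text \<open>
  Why the correspondence holds. Write \<open>R[f]\<close> for the kernel pair of \<open>f\<close>. Every effective
  equivalence relation \<open>S\<close> on \<open>X\<close> is \<open>R[q]\<close> for its quotient map \<open>q : X \<rightarrow> X/S\<close>, and the inverse
  image of \<open>R[g]\<close> along \<open>f\<close> is \<open>R[g \<cdot> f]\<close> (\<open>inv_image_kernel_pair\<close>). So statements about effective
  equivalence relations, their inclusions and their inverse images are statements about arrows
  and the pairs of generalized elements that they identify; the relation \<open>kernel_le\<close> expresses
  inclusion in this form.

  An epireflective subcategory with unit \<open>\<eta>\<close> yields the closure \<open>R[\<eta> \<cdot> q]\<close> of \<open>R[q]\<close>: two elements of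
  \<open>X\<close> are identified by the closure iff every arrow that identifies \<open>S\<close> and ends in the
  subcategory identifies them. The first four axioms follow from this description. For the
  fifth, along a regular epimorphism \<open>f\<close>, an arrow that identifies the inverse image of
  \<open>S\<close> factors through \<open>f\<close>, so that \<open>S\<close> and its inverse image have the same reflected quotient
  (\<open>quotient_reflection_precomp\<close>). The subcategory is recovered from its closure operator as the
  objects with closed diagonal: the closure of the diagonal of \<open>A\<close> is \<open>R[\<eta>]\<close> for the unit
  at \<open>A\<close>, and a regular epimorphism with trivial kernel pair is invertible
  (\<open>closed_objects_reflection_closure\<close>).

  Conversely, an effective closure operator determines the full subcategory of objects with closed
  diagonal. The reflection of \<open>X\<close> is the quotient \<open>e\<close> of \<open>X\<close> by the closure of its diagonal. Its
  codomain has closed diagonal by idempotence and the fifth axiom, because inverse image along a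
  regular epimorphism reflects inclusions (\<open>kernel_le_cancel\<close>, \<open>closure_diagonal_quotient\<close>); and
  \<open>e\<close> is universal, because an arrow to an object with closed diagonal has a closed kernel
  pair (\<open>closure_le_kernel_pair\<close>). Finally the fifth axiom for \<open>q\<close> turns the closure of \<open>R[q]\<close>
  into the inverse image of the closure of a diagonal, so that the operator obtained from this
  subcategory is the given one (\<open>closure_is_reflection_closure\<close>).
\<close>

section \<open>Arrows, products and regular epimorphisms\<close>

lemma hom_iff: "f \<in> hom C A B \<longleftrightarrow> f \<in> Arr C \<and> Dom C f = A \<and> Cod C f = B"
  by (simp add: hom_def)

context category
begin

lemma comp_arr [simp]:
  assumes "f \<in> Arr C" "g \<in> Arr C" "Cod C f = Dom C g"
  shows "g \<cdot> f \<in> Arr C" "Dom C (g \<cdot> f) = Dom C f" "Cod C (g \<cdot> f) = Cod C g"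
  using Comp_in_hom[of f "Dom C f" "Cod C f" g "Cod C g"] assms by (simp_all add: hom_iff)

lemma comp_assoc [simp]:
  assumes "f \<in> Arr C" "g \<in> Arr C" "h \<in> Arr C" "Cod C f = Dom C g" "Cod C g = Dom C h"
  shows "(h \<cdot> g) \<cdot> f = h \<cdot> (g \<cdot> f)"
  using Comp_assoc[of f "Dom C f" "Cod C f" g "Cod C g" h "Cod C h"] assms by (simp add: hom_iff)

lemma idn_arr [simp]:
  assumes "A \<in> Ob C"
  shows "Idn C A \<in> Arr C" "Dom C (Idn C A) = A" "Cod C (Idn C A) = A"
  using Idn_in_hom[OF assms] by (simp_all add: hom_iff)

lemma idn_left [simp]: "f \<in> Arr C \<Longrightarrow> Cod C f = A \<Longrightarrow> Idn C A \<cdot> f = f"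
  using Idn_left[of f "Dom C f" A] by (simp add: hom_iff)

lemma idn_right [simp]: "f \<in> Arr C \<Longrightarrow> Dom C f = A \<Longrightarrow> f \<cdot> Idn C A = f"
  using Idn_right[of f A "Cod C f"] by (simp add: hom_iff)

lemma dom_cod_ob [simp]: "f \<in> Arr C \<Longrightarrow> Dom C f \<in> Ob C" "f \<in> Arr C \<Longrightarrow> Cod C f \<in> Ob C"
  by (rule Dom_in_Ob Cod_in_Ob, assumption)+

lemma factors_trans:
  assumes "factors C u m" "factors C m n" "m \<in> Arr C" "n \<in> Arr C"
  shows "factors C u n"
proof -
  obtain k l where "k \<in> hom C (Dom C u) (Dom C m)" "m \<cdot> k = u"
    and "l \<in> hom C (Dom C m) (Dom C n)" "n \<cdot> l = m"
    using assms by (auto simp: factors_def)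
  then show ?thesis
    using assms(3,4) unfolding factors_def
    by (intro bexI[of _ "l \<cdot> k"]) (auto simp: hom_iff simp flip: comp_assoc)
qed

end

locale regular_category = category +
  assumes finitely_complete: "finitely_complete C" and regular: "regular C"
begin

text \<open>The product of \<open>X\<close> with itself is the limit of the constant diagram at \<open>X\<close> on the discrete
  category with objects \<open>0\<close> and \<open>1\<close>.\<close>

lemma square_is_product:
  assumes X: "X \<in> Ob C"
  shows "is_product C X X (square C X)"
proof -
  define J :: "(nat, nat) category" where
    "J = \<lparr>Ob = {0, 1}, Arr = {0, 1}, Dom = \<lambda>i. i, Cod = \<lambda>i. i, Idn = \<lambda>i. i, Comp = \<lambda>_ f. f\<rparr>"
  define F :: "(nat, nat, 'a, 'b) fnctr" where
    "F = \<lparr>on_ob = \<lambda>_. X, on_arr = \<lambda>_. Idn C X\<rparr>"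
  have "category J"
    by (unfold_locales) (auto simp: J_def hom_def)
  moreover have "is_functor J C F"
    using X by (auto simp: is_functor_def J_def F_def hom_iff)
  moreover have "finite (Ob J)" "finite (Arr J)"
    by (auto simp: J_def)
  ultimately obtain L \<pi> where lim: "is_limit J C F L \<pi>"
    using finitely_complete unfolding finitely_complete_def by blast
  have "\<exists>!u. u \<in> hom C A L \<and> \<pi> 0 \<cdot> u = a \<and> \<pi> 1 \<cdot> u = b"
    if "A \<in> Ob C" "a \<in> hom C A X" "b \<in> hom C A X" for A a b
  proof -
    have "is_cone J C F A (\<lambda>i. if i = 0 then a else b)"
      using that by (auto simp: is_cone_def J_def F_def hom_iff)
    then have "\<exists>!u. u \<in> hom C A L \<and> (\<forall>i\<in>Ob J. \<pi> i \<cdot> u = (if i = 0 then a else b))"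
      using lim unfolding is_limit_def by blast
    then show ?thesis
      by (simp add: J_def)
  qed
  moreover have "\<pi> 0 \<in> hom C L X" "\<pi> 1 \<in> hom C L X"
    using lim by (auto simp: is_limit_def is_cone_def J_def F_def)
  ultimately have "is_product C X X (L, \<pi> 0, \<pi> 1)"
    by (simp add: is_product_def)
  then show ?thesis
    unfolding square_def by (rule someI)
qed

lemma pr_arr [simp]:
  assumes "X \<in> Ob C"
  shows "pr1 C X \<in> Arr C" "Dom C (pr1 C X) = sq C X" "Cod C (pr1 C X) = X"
    and "pr2 C X \<in> Arr C" "Dom C (pr2 C X) = sq C X" "Cod C (pr2 C X) = X"
  using square_is_product[OF assms]
  by (auto simp: is_product_def pr1_def pr2_def sq_def hom_iff split: prod.splits)

lemma square_universal:
  assumes "a \<in> hom C A X" "b \<in> hom C A X"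
  shows "\<exists>!u. u \<in> hom C A (sq C X) \<and> pr1 C X \<cdot> u = a \<and> pr2 C X \<cdot> u = b"
proof -
  have "A \<in> Ob C" "X \<in> Ob C"
    using assms by (auto simp: hom_iff)
  then show ?thesis
    using square_is_product[of X] assms
    by (auto simp: is_product_def pr1_def pr2_def sq_def split: prod.splits)
qed

lemma pairing [simp]:
  assumes "a \<in> Arr C" "b \<in> Arr C" "Dom C a = Dom C b" "Cod C a = Cod C b"
  shows "pairing C a b \<in> Arr C" "Dom C (pairing C a b) = Dom C a"
    "Cod C (pairing C a b) = sq C (Cod C a)"
    and "pr1 C (Cod C a) \<cdot> pairing C a b = a" "pr2 C (Cod C a) \<cdot> pairing C a b = b"
proof -
  have "\<exists>!u. u \<in> hom C (Dom C a) (sq C (Cod C a)) \<and>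
      pr1 C (Cod C a) \<cdot> u = a \<and> pr2 C (Cod C a) \<cdot> u = b"
    using assms by (intro square_universal) (auto simp: hom_iff)
  from theI'[OF this]
  show "pairing C a b \<in> Arr C" "Dom C (pairing C a b) = Dom C a"
    "Cod C (pairing C a b) = sq C (Cod C a)"
    "pr1 C (Cod C a) \<cdot> pairing C a b = a" "pr2 C (Cod C a) \<cdot> pairing C a b = b"
    unfolding pairing_def by (auto simp: hom_iff)
qed

lemma square_eqI:
  assumes "X \<in> Ob C" "u \<in> hom C A (sq C X)" "v \<in> hom C A (sq C X)"
    and "pr1 C X \<cdot> u = pr1 C X \<cdot> v" "pr2 C X \<cdot> u = pr2 C X \<cdot> v"
  shows "u = v"
proof -
  have "pr1 C X \<cdot> v \<in> hom C A X" "pr2 C X \<cdot> v \<in> hom C A X"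
    using assms by (auto simp: hom_iff)
  from square_universal[OF this] show ?thesis
    using assms by blast
qed

lemma pairing_projections:
  assumes "m \<in> Arr C" "Cod C m = sq C X" "X \<in> Ob C"
  shows "pairing C (pr1 C X \<cdot> m) (pr2 C X \<cdot> m) = m"
proof (rule square_eqI[of X])
  let ?a = "pr1 C X \<cdot> m" and ?b = "pr2 C X \<cdot> m"
  have c: "Cod C ?a = X" "?a \<in> Arr C" "?b \<in> Arr C" "Dom C ?a = Dom C ?b" "Cod C ?a = Cod C ?b"
    using assms by auto
  show "pr1 C X \<cdot> pairing C ?a ?b = ?a" "pr2 C X \<cdot> pairing C ?a ?b = ?b"
    using pairing(4,5)[of ?a ?b] c by auto
  show "pairing C ?a ?b \<in> hom C (Dom C m) (sq C X)" "m \<in> hom C (Dom C m) (sq C X)"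
    using pairing(1-3)[of ?a ?b] c assms by (auto simp: hom_iff)
qed (use assms in auto)

lemma sq_arr [simp]:
  assumes "f \<in> Arr C"
  shows "sq_arr C f \<in> Arr C" "Dom C (sq_arr C f) = sq C (Dom C f)"
    "Cod C (sq_arr C f) = sq C (Cod C f)"
    and "pr1 C (Cod C f) \<cdot> sq_arr C f = f \<cdot> pr1 C (Dom C f)"
    "pr2 C (Cod C f) \<cdot> sq_arr C f = f \<cdot> pr2 C (Dom C f)"
  using pairing[of "f \<cdot> pr1 C (Dom C f)" "f \<cdot> pr2 C (Dom C f)"] assms
  unfolding sq_arr_def by auto

lemma regular_epiD:
  assumes "is_regular_epi C q"
  shows "q \<in> Arr C"
    and "\<And>h k. h \<in> hom C (Cod C q) B \<Longrightarrow> k \<in> hom C (Cod C q) B \<Longrightarrow> h \<cdot> q = k \<cdot> q \<Longrightarrow> h = k"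
proof -
  obtain f g where co: "is_coequalizer C f g q"
    using assms by (auto simp: is_regular_epi_def)
  then show q: "q \<in> Arr C"
    unfolding is_coequalizer_def by blast
  fix h k assume h: "h \<in> hom C (Cod C q) B" and k: "k \<in> hom C (Cod C q) B" and eq: "h \<cdot> q = k \<cdot> q"
  have fg: "f \<in> Arr C" "g \<in> Arr C" "Dom C f = Dom C g" "Cod C f = Dom C q" "Cod C g = Dom C q"
    "q \<cdot> f = q \<cdot> g"
    using co unfolding is_coequalizer_def by metis+
  have "k \<cdot> q \<in> Arr C" "Dom C (k \<cdot> q) = Cod C f" "(k \<cdot> q) \<cdot> f = (k \<cdot> q) \<cdot> g"
    using k q fg by (simp_all add: hom_iff)
  then have "\<exists>!l. l \<in> hom C (Cod C q) (Cod C (k \<cdot> q)) \<and> l \<cdot> q = k \<cdot> q"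
    using co unfolding is_coequalizer_def by blast
  moreover have "Cod C (k \<cdot> q) = B"
    using k q by (simp add: hom_iff)
  ultimately show "h = k"
    using h k eq by blast
qed

end

text \<open>Inclusion of kernel pairs, expressed by the arrows alone: this replaces computations with
  subobjects of a square by computations with parallel pairs.\<close>

definition kernel_le :: "('o, 'a) category \<Rightarrow> 'a \<Rightarrow> 'a \<Rightarrow> bool" where
  "kernel_le C f g \<longleftrightarrow> (\<forall>A\<in>Ob C. \<forall>u\<in>hom C A (Dom C f). \<forall>v\<in>hom C A (Dom C f).
     f \<cdot>\<^bsub>C\<^esub> u = f \<cdot>\<^bsub>C\<^esub> v \<longrightarrow> g \<cdot>\<^bsub>C\<^esub> u = g \<cdot>\<^bsub>C\<^esub> v)"

context category
begin

lemma kernel_leD: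
  assumes "kernel_le C f g" "u \<in> hom C A (Dom C f)" "v \<in> hom C A (Dom C f)" "f \<cdot> u = f \<cdot> v"
  shows "g \<cdot> u = g \<cdot> v"
proof -
  have "A \<in> Ob C"
    using assms(2) by (auto simp: hom_iff)
  with assms(1) have "f \<cdot> u = f \<cdot> v \<longrightarrow> g \<cdot> u = g \<cdot> v"
    using assms(2,3) unfolding kernel_le_def by blast
  then show ?thesis
    using assms(4) by (rule mp)
qed

lemma kernel_leI:
  assumes "\<And>A u v. A \<in> Ob C \<Longrightarrow> u \<in> hom C A (Dom C f) \<Longrightarrow> v \<in> hom C A (Dom C f) \<Longrightarrow>
    f \<cdot> u = f \<cdot> v \<Longrightarrow> g \<cdot> u = g \<cdot> v"
  shows "kernel_le C f g"
  unfolding kernel_le_def by (intro ballI impI assms)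

lemma kernel_le_refl: "kernel_le C f f"
  by (simp add: kernel_le_def)

lemma kernel_le_trans:
  assumes fg: "kernel_le C f g" and gh: "kernel_le C g h" and dom: "Dom C f = Dom C g"
  shows "kernel_le C f h"
proof (rule kernel_leI)
  fix A u v assume uv: "u \<in> hom C A (Dom C f)" "v \<in> hom C A (Dom C f)" and "f \<cdot> u = f \<cdot> v"
  then have "g \<cdot> u = g \<cdot> v"
    by (rule kernel_leD[OF fg])
  then show "h \<cdot> u = h \<cdot> v"
    by (rule kernel_leD[OF gh uv[unfolded dom]])
qed

lemma kernel_le_comp:
  assumes "f \<in> Arr C" "k \<in> Arr C" "Cod C f = Dom C k"
  shows "kernel_le C f (k \<cdot> f)"
  using assms by (intro kernel_leI) (simp add: hom_iff)

lemma kernel_le_precomp: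
  assumes "kernel_le C g h" "f \<in> Arr C" "g \<in> Arr C" "h \<in> Arr C" "Cod C f = Dom C g" "Cod C f = Dom C h"
  shows "kernel_le C (g \<cdot> f) (h \<cdot> f)"
proof (rule kernel_leI)
  fix A u v assume "u \<in> hom C A (Dom C (g \<cdot> f))" "v \<in> hom C A (Dom C (g \<cdot> f))"
    and "(g \<cdot> f) \<cdot> u = (g \<cdot> f) \<cdot> v"
  then show "(h \<cdot> f) \<cdot> u = (h \<cdot> f) \<cdot> v"
    using assms kernel_leD[OF assms(1), of "f \<cdot> u" A "f \<cdot> v"] by (simp add: hom_iff)
qed

end

context regular_category
begin

text \<open>If \<open>q\<close> is a coequalizer of \<open>x\<close> and \<open>y\<close>, then \<open>q\<close> and hence every \<open>h\<close> with a larger kernel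
  identifies \<open>x\<close> and \<open>y\<close>.\<close>

lemma regular_epi_factor:
  assumes q: "is_regular_epi C q" and h: "h \<in> Arr C" "Dom C h = Dom C q" and le: "kernel_le C q h"
  obtains k where "k \<in> hom C (Cod C q) (Cod C h)" "k \<cdot> q = h"
proof -
  obtain x y where co: "is_coequalizer C x y q"
    using q by (auto simp: is_regular_epi_def)
  have xy: "x \<in> hom C (Dom C x) (Dom C q)" "y \<in> hom C (Dom C x) (Dom C q)" "q \<cdot> x = q \<cdot> y"
    and d: "Dom C h = Cod C x"
    using co h unfolding is_coequalizer_def hom_iff by metis+
  have "h \<cdot> x = h \<cdot> y"
    by (rule kernel_leD[OF le xy])
  then have "\<exists>!k. k \<in> hom C (Cod C q) (Cod C h) \<and> k \<cdot> q = h"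
    using co h(1) d unfolding is_coequalizer_def by blast
  then show ?thesis
    using that by blast
qed

text \<open>Generalized elements of the codomain of a regular epimorphism lift after passing to a cover
  of their stage of definition, because regular epimorphisms are stable under pullback.\<close>

lemma regular_epi_lift:
  assumes f: "is_regular_epi C f" and u: "u \<in> hom C A (Cod C f)"
  obtains p u' where "is_regular_epi C p" "Cod C p = A" "u' \<in> hom C (Dom C p) (Dom C f)" "f \<cdot> u' = u \<cdot> p"
proof -
  have "u \<in> Arr C" "Cod C f = Cod C u"
    using u by (simp_all add: hom_iff)
  then obtain a p where pb: "is_pullback C f u a p"
    using regular f unfolding regular_def by blast
  moreover from pb f have "is_regular_epi C p"
    using regular unfolding regular_def by blast
  ultimately show ?thesis
    using u by (intro that[of p a]) (auto simp: is_pullback_def hom_iff)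
qed

text \<open>To compare \<open>u\<close> and \<open>v\<close> after composition with \<open>k\<close>, lift first \<open>u\<close> along \<open>f\<close> over a cover \<open>p\<close>
  and then \<open>v \<cdot> p\<close> over a cover \<open>r\<close>. The lifts have the same image under \<open>h \<cdot> f\<close>, hence under
  \<open>k \<cdot> f\<close>, and the epimorphisms \<open>r\<close> and \<open>p\<close> can be cancelled.\<close>

lemma regular_epi_cover_eqI:
  assumes f: "is_regular_epi C f" and h: "h \<in> Arr C" "Dom C h = Cod C f"
    and k: "k \<in> Arr C" "Dom C k = Cod C f"
    and uv: "u \<in> hom C A (Cod C f)" "v \<in> hom C A (Cod C f)" "h \<cdot> u = h \<cdot> v"
    and le: "kernel_le C (h \<cdot> f) (k \<cdot> f)"
  shows "k \<cdot> u = k \<cdot> v"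
proof -
  have fa: "f \<in> Arr C"
    by (rule regular_epiD(1)[OF f])
  obtain p u' where p: "is_regular_epi C p" "Cod C p = A" and u': "u' \<in> hom C (Dom C p) (Dom C f)" "f \<cdot> u' = u \<cdot> p"
    using regular_epi_lift[OF f uv(1)] by blast
  have pa: "p \<in> Arr C"
    by (rule regular_epiD(1)[OF p(1)])
  have "v \<cdot> p \<in> hom C (Dom C p) (Cod C f)"
    using uv pa p by (auto simp: hom_iff)
  then obtain r v' where r: "is_regular_epi C r" "Cod C r = Dom C p"
    and v': "v' \<in> hom C (Dom C r) (Dom C f)" "f \<cdot> v' = (v \<cdot> p) \<cdot> r"
    using regular_epi_lift[OF f] by blast
  have ra: "r \<in> Arr C"
    by (rule regular_epiD(1)[OF r(1)])
  note arrs = fa pa ra h k uv(1,2) u'(1) v'(1) p(2) r(2)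
  have u'': "f \<cdot> (u' \<cdot> r) = u \<cdot> (p \<cdot> r)" and v'': "f \<cdot> v' = v \<cdot> (p \<cdot> r)"
    using arrs u'(2) v'(2) by (auto simp: hom_iff simp flip: comp_assoc)
  have hom: "u \<cdot> (p \<cdot> r) \<in> hom C (Dom C r) (Cod C f)" "v \<cdot> (p \<cdot> r) \<in> hom C (Dom C r) (Cod C f)"
    "u' \<cdot> r \<in> hom C (Dom C r) (Dom C f)"
    using arrs by (simp_all add: hom_iff)
  have lift: "(l \<cdot> f) \<cdot> (u' \<cdot> r) = ((l \<cdot> u) \<cdot> p) \<cdot> r" "(l \<cdot> f) \<cdot> v' = ((l \<cdot> v) \<cdot> p) \<cdot> r"
    if l: "l \<in> Arr C" "Dom C l = Cod C f" for l
  proof -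
    have "(l \<cdot> f) \<cdot> (u' \<cdot> r) = l \<cdot> (f \<cdot> (u' \<cdot> r))" "(l \<cdot> f) \<cdot> v' = l \<cdot> (f \<cdot> v')"
      using l fa v'(1) hom(3) by (simp_all add: hom_iff)
    moreover have "((l \<cdot> u) \<cdot> p) \<cdot> r = l \<cdot> (u \<cdot> (p \<cdot> r))" "((l \<cdot> v) \<cdot> p) \<cdot> r = l \<cdot> (v \<cdot> (p \<cdot> r))"
      using arrs l by (simp_all add: hom_iff)
    ultimately show "(l \<cdot> f) \<cdot> (u' \<cdot> r) = ((l \<cdot> u) \<cdot> p) \<cdot> r" "(l \<cdot> f) \<cdot> v' = ((l \<cdot> v) \<cdot> p) \<cdot> r"
      by (simp_all only: u'' v'')
  qed
  have "(h \<cdot> f) \<cdot> (u' \<cdot> r) = (h \<cdot> f) \<cdot> v'"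
    using lift[OF h] uv(3) by simp
  moreover have "Dom C (h \<cdot> f) = Dom C f"
    using fa h by simp
  ultimately have "(k \<cdot> f) \<cdot> (u' \<cdot> r) = (k \<cdot> f) \<cdot> v'"
    using kernel_leD[OF le, of "u' \<cdot> r" "Dom C r" v'] hom(3) v'(1) by metis
  then have eq: "((k \<cdot> u) \<cdot> p) \<cdot> r = ((k \<cdot> v) \<cdot> p) \<cdot> r"
    using lift[OF k] by metis
  have homk: "k \<cdot> u \<in> hom C A (Cod C k)" "k \<cdot> v \<in> hom C A (Cod C k)"
    using uv k by (simp_all add: hom_iff)
  then have homkp: "(k \<cdot> u) \<cdot> p \<in> hom C (Dom C p) (Cod C k)" "(k \<cdot> v) \<cdot> p \<in> hom C (Dom C p) (Cod C k)"
    using Comp_in_hom[of p "Dom C p" A] pa p(2) by (simp_all add: hom_iff del: comp_assoc)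
  have "(k \<cdot> u) \<cdot> p = (k \<cdot> v) \<cdot> p"
    using regular_epiD(2)[OF r(1) _ _ eq] homkp r(2) by simp
  then show ?thesis
    using regular_epiD(2)[OF p(1)] homk p(2) by metis
qed

text \<open>In terms of relations: inverse image along a regular epimorphism reflects inclusions.\<close>

lemma kernel_le_cancel:
  assumes "is_regular_epi C f" "h \<in> Arr C" "Dom C h = Cod C f" "k \<in> Arr C" "Dom C k = Cod C f"
    and "kernel_le C (h \<cdot> f) (k \<cdot> f)"
  shows "kernel_le C h k"
  by (rule kernel_leI, unfold assms(3)) (rule regular_epi_cover_eqI[OF assms(1-5) _ _ _ assms(6)])

text \<open>The quotient by the kernel pair of \<open>f\<close>: the coequalizer of the kernel pair of \<open>f\<close> has
  the same kernel pair, since \<open>f\<close> factors through it.\<close>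

lemma quotient_exists:
  assumes f: "f \<in> Arr C"
  obtains q where "is_regular_epi C q" "Dom C q = Dom C f" "kernel_le C f q" "kernel_le C q f"
proof -
  obtain x y where pb: "is_pullback C f f x y"
    using regular f unfolding regular_def by blast
  then obtain q where co: "is_coequalizer C x y q"
    using regular unfolding regular_def by blast
  have xy: "x \<in> Arr C" "y \<in> Arr C" "Dom C x = Dom C y" "Cod C x = Dom C f" "Cod C y = Dom C f"
    "f \<cdot> x = f \<cdot> y"
    using pb by (auto simp: is_pullback_def)
  have q: "q \<in> Arr C" "Dom C q = Dom C f" "q \<cdot> x = q \<cdot> y"
    using co xy unfolding is_coequalizer_def by metis+
  have "Dom C f = Cod C x"
    using xy by simp
  then have "\<exists>k. k \<in> hom C (Cod C q) (Cod C f) \<and> k \<cdot> q = f"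
    using co f xy(6) unfolding is_coequalizer_def by blast
  then have "kernel_le C q f"
    using kernel_le_comp q(1) by (auto simp: hom_iff)
  moreover have "kernel_le C f q"
  proof (rule kernel_leI)
    fix A u v assume uv: "A \<in> Ob C" "u \<in> hom C A (Dom C f)" "v \<in> hom C A (Dom C f)" "f \<cdot> u = f \<cdot> v"
    then obtain w where w: "w \<in> hom C A (Dom C x)" and "x \<cdot> w = u" "y \<cdot> w = v"
      using pb unfolding is_pullback_def by blast
    then show "q \<cdot> u = q \<cdot> v"
      using xy q comp_assoc[of w x q] comp_assoc[of w y q] by (auto simp: hom_iff)
  qed
  ultimately show ?thesis
    using co q that by (auto simp: is_regular_epi_def)
qed

lemma regular_epi_kernel_trivial_iso:
  assumes q: "is_regular_epi C q" and le: "kernel_le C q (Idn C (Dom C q))"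
  shows "is_iso C q"
proof -
  have qa: "q \<in> Arr C"
    by (rule regular_epiD(1)[OF q])
  obtain k where k: "k \<in> hom C (Cod C q) (Dom C q)" "k \<cdot> q = Idn C (Dom C q)"
    using regular_epi_factor[OF q _ _ le] qa by auto
  have "q \<cdot> k = Idn C (Cod C q)"
    using k qa by - (rule regular_epiD(2)[OF q, of _ "Cod C q"]; auto simp: hom_iff)
  then show ?thesis
    using k qa by (auto simp: is_iso_def)
qed

section \<open>Effective equivalence relations\<close>

lemma kernel_pairD:
  assumes "m \<in> kernel_pair C f"
  shows "m \<in> Arr C" "Cod C m = sq C (Dom C f)"
    and "f \<cdot> (pr1 C (Dom C f) \<cdot> m) = f \<cdot> (pr2 C (Dom C f) \<cdot> m)"
  using assms by (auto simp: kernel_pair_def is_pullback_def)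

lemma kernel_pair_nonempty:
  assumes f: "f \<in> Arr C"
  obtains m where "m \<in> kernel_pair C f"
proof -
  obtain x y where pb: "is_pullback C f f x y"
    using regular f unfolding regular_def by blast
  then have xy: "x \<in> Arr C" "y \<in> Arr C" "Dom C x = Dom C y" "Cod C x = Dom C f" "Cod C y = Dom C f"
    by (auto simp: is_pullback_def)
  then have "pairing C x y \<in> kernel_pair C f"
    using pb pairing[of x y] by (simp add: kernel_pair_def)
  then show ?thesis
    by (rule that)
qed

lemma kernel_pair_factors:
  assumes f: "f \<in> Arr C" and m: "m \<in> kernel_pair C f"
    and u: "u \<in> hom C A (Dom C f)" and v: "v \<in> hom C A (Dom C f)"
  shows "factors C (pairing C u v) m \<longleftrightarrow> f \<cdot> u = f \<cdot> v"
proof -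
  let ?X = "Dom C f"
  note mD = kernel_pairD[OF m]
  have X: "?X \<in> Ob C" and A: "A \<in> Ob C"
    using f u by (auto simp: hom_iff)
  have pr: "pr1 C ?X \<cdot> pairing C u v = u" "pr2 C ?X \<cdot> pairing C u v = v"
    and pa: "pairing C u v \<in> Arr C" "Dom C (pairing C u v) = A" "Cod C (pairing C u v) = sq C ?X"
    using pairing[of u v] u v by (auto simp: hom_iff)
  show ?thesis
  proof
    assume "factors C (pairing C u v) m"
    then obtain k where k: "k \<in> hom C A (Dom C m)" "m \<cdot> k = pairing C u v"
      using pa by (auto simp: factors_def)
    have "u = (pr1 C ?X \<cdot> m) \<cdot> k" "v = (pr2 C ?X \<cdot> m) \<cdot> k"
      using pr k mD X by (auto simp: hom_iff)
    then have "f \<cdot> u = (f \<cdot> (pr1 C ?X \<cdot> m)) \<cdot> k" "f \<cdot> v = (f \<cdot> (pr2 C ?X \<cdot> m)) \<cdot> k"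
      using f k(1) mD(1,2) X by (auto simp: hom_iff)
    then show "f \<cdot> u = f \<cdot> v"
      by (simp only: mD(3))
  next
    assume "f \<cdot> u = f \<cdot> v"
    moreover have "is_pullback C f f (pr1 C ?X \<cdot> m) (pr2 C ?X \<cdot> m)"
      using m by (simp add: kernel_pair_def)
    moreover have "Dom C (pr1 C ?X \<cdot> m) = Dom C m"
      using mD X by simp
    ultimately obtain k where k: "k \<in> hom C A (Dom C m)"
      "(pr1 C ?X \<cdot> m) \<cdot> k = u" "(pr2 C ?X \<cdot> m) \<cdot> k = v"
      using u v A unfolding is_pullback_def by metis
    have "m \<cdot> k = pairing C u v"
      using k pr mD X pa by - (rule square_eqI[of ?X _ A]; auto simp: hom_iff)
    then show "factors C (pairing C u v) m"
      using k pa by (auto simp: factors_def)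
  qed
qed

lemma kernel_pair_mono:
  assumes f: "f \<in> Arr C" and m: "m \<in> kernel_pair C f"
  shows "is_mono C m"
  unfolding is_mono_def
proof (intro conjI ballI impI)
  let ?X = "Dom C f"
  note mD = kernel_pairD[OF m]
  show "m \<in> Arr C" by (rule mD)
  fix A u v
  assume A: "A \<in> Ob C" and uv: "u \<in> hom C A (Dom C m)" "v \<in> hom C A (Dom C m)" "m \<cdot> u = m \<cdot> v"
  let ?p = "pr1 C ?X \<cdot> m" and ?q = "pr2 C ?X \<cdot> m"
  have eqs: "?p \<cdot> v = ?p \<cdot> u" "?q \<cdot> v = ?q \<cdot> u"
    using uv mD f by (auto simp: hom_iff)
  have d: "Dom C ?p = Dom C m" and pq: "?p \<in> hom C (Dom C m) ?X" "?q \<in> hom C (Dom C m) ?X"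
    using mD f by (auto simp: hom_iff)
  have "f \<cdot> (?p \<cdot> u) = (f \<cdot> ?p) \<cdot> u" "f \<cdot> (?q \<cdot> u) = (f \<cdot> ?q) \<cdot> u"
    using uv pq f comp_assoc[of u ?p f] comp_assoc[of u ?q f] unfolding hom_iff by metis+
  then have fpq: "f \<cdot> (?p \<cdot> u) = f \<cdot> (?q \<cdot> u)"
    by (simp only: mD(3))
  have "?p \<cdot> u \<in> hom C A ?X" "?q \<cdot> u \<in> hom C A ?X"
    using uv pq by (auto intro: Comp_in_hom)
  then have "\<exists>!w. w \<in> hom C A (Dom C ?p) \<and> ?p \<cdot> w = ?p \<cdot> u \<and> ?q \<cdot> w = ?q \<cdot> u"
    using m A fpq unfolding kernel_pair_def is_pullback_def by blast
  then show "u = v"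
    using uv(1,2) eqs d by auto
qed

text \<open>A monomorphism that classifies the same pairs of generalized elements as the kernel pair
  of \<open>f\<close> represents it.\<close>

lemma kernel_pairI:
  assumes f: "f \<in> Arr C" and m: "is_mono C m" "Cod C m = sq C (Dom C f)"
    and fac: "\<And>A u v. A \<in> Ob C \<Longrightarrow> u \<in> hom C A (Dom C f) \<Longrightarrow> v \<in> hom C A (Dom C f) \<Longrightarrow>
      factors C (pairing C u v) m \<longleftrightarrow> f \<cdot> u = f \<cdot> v"
  shows "m \<in> kernel_pair C f"
proof -
  let ?X = "Dom C f"
  let ?p = "pr1 C ?X \<cdot> m" and ?q = "pr2 C ?X \<cdot> m"
  have X: "?X \<in> Ob C" and ma: "m \<in> Arr C"
    using f m by (auto simp: is_mono_def)
  have pq: "?p \<in> hom C (Dom C m) ?X" "?q \<in> hom C (Dom C m) ?X"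
    using X ma m by (auto simp: hom_iff)
  have "factors C (pairing C ?p ?q) m"
    using pairing_projections[OF ma m(2) X] ma unfolding factors_def
    by (intro bexI[of _ "Idn C (Dom C m)"]) (auto simp: hom_iff)
  then have eq: "f \<cdot> ?p = f \<cdot> ?q"
    using fac[OF _ pq] ma by simp
  have "\<exists>!w. w \<in> hom C A (Dom C ?p) \<and> ?p \<cdot> w = a \<and> ?q \<cdot> w = b"
    if A: "A \<in> Ob C" and ab: "a \<in> hom C A ?X" "b \<in> hom C A ?X" "f \<cdot> a = f \<cdot> b" for A a b
  proof -
    have pr: "pr1 C ?X \<cdot> pairing C a b = a" "pr2 C ?X \<cdot> pairing C a b = b"
      and pa: "pairing C a b \<in> hom C A (sq C ?X)"
      using pairing[of a b] ab by (auto simp: hom_iff)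
    obtain k where k: "k \<in> hom C A (Dom C m)" "m \<cdot> k = pairing C a b"
      using fac[of A a b] A ab pa by (auto simp: factors_def hom_iff)
    show ?thesis
    proof (rule ex1I[of _ k])
      show "k \<in> hom C A (Dom C ?p) \<and> ?p \<cdot> k = a \<and> ?q \<cdot> k = b"
        using k pr X ma m pq by (auto simp: hom_iff)
    next
      fix w assume w: "w \<in> hom C A (Dom C ?p) \<and> ?p \<cdot> w = a \<and> ?q \<cdot> w = b"
      then have wh: "w \<in> hom C A (Dom C m)"
        using pq by (simp add: hom_iff)
      have "m \<cdot> w = m \<cdot> k"
        using w wh k pr X ma m by - (rule square_eqI[of ?X _ A]; auto simp: hom_iff)
      then show "w = k"
        using m(1) wh k A unfolding is_mono_def by blast
    qed
  qed
  then have "is_pullback C f f ?p ?q"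
    unfolding is_pullback_def using pq f eq by (intro conjI ballI impI) (simp_all add: hom_iff)
  then show ?thesis
    using ma m by (simp add: kernel_pair_def)
qed

lemma kernel_pair_factors_iff:
  assumes fg: "f \<in> Arr C" "g \<in> Arr C" "Dom C f = Dom C g"
    and m: "m \<in> kernel_pair C f" and n: "n \<in> kernel_pair C g"
  shows "factors C m n \<longleftrightarrow> kernel_le C f g"
proof
  note mD = kernel_pairD[OF m] and nD = kernel_pairD[OF n]
  {
    assume mn: "factors C m n"
    show "kernel_le C f g"
    proof (rule kernel_leI)
      fix A u v assume uv: "u \<in> hom C A (Dom C f)" "v \<in> hom C A (Dom C f)" "f \<cdot> u = f \<cdot> v"
      then have "factors C (pairing C u v) m"
        using kernel_pair_factors[OF fg(1) m] by blast
      from factors_trans[OF this mn mD(1) nD(1)] show "g \<cdot> u = g \<cdot> v"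
        using kernel_pair_factors[OF fg(2) n] uv fg(3) by auto
    qed
  next
    assume le: "kernel_le C f g"
    let ?X = "Dom C f"
    let ?p = "pr1 C ?X \<cdot> m" and ?q = "pr2 C ?X \<cdot> m"
    have X: "?X \<in> Ob C"
      using fg by auto
    have pq: "?p \<in> hom C (Dom C m) ?X" "?q \<in> hom C (Dom C m) ?X"
      using X mD by (auto simp: hom_iff)
    have "g \<cdot> ?p = g \<cdot> ?q"
      using kernel_leD[OF le pq mD(3)] .
    then have "factors C (pairing C ?p ?q) n"
      using kernel_pair_factors[OF fg(2) n] pq fg(3) by auto
    then show "factors C m n"
      using pairing_projections[OF mD(1,2) X] by simp
  }
qed

lemma sub_le_kernel_pair:
  assumes "f \<in> Arr C" "g \<in> Arr C" "Dom C f = Dom C g"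
  shows "sub_le C (kernel_pair C f) (kernel_pair C g) \<longleftrightarrow> kernel_le C f g"
proof -
  obtain m n where "m \<in> kernel_pair C f" "n \<in> kernel_pair C g"
    using kernel_pair_nonempty assms by metis
  then show ?thesis
    unfolding sub_le_def using kernel_pair_factors_iff[OF assms] by blast
qed

lemma kernel_pair_eq_iff:
  assumes "f \<in> Arr C" "g \<in> Arr C" "Dom C f = Dom C g"
  shows "kernel_pair C f = kernel_pair C g \<longleftrightarrow> kernel_le C f g \<and> kernel_le C g f"
proof
  assume "kernel_pair C f = kernel_pair C g"
  then show "kernel_le C f g \<and> kernel_le C g f"
    using sub_le_kernel_pair[of f g] sub_le_kernel_pair[of g f] sub_le_kernel_pair[of f f]
      assms kernel_le_refl by auto
next
  assume le: "kernel_le C f g \<and> kernel_le C g f"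
  have sub: "kernel_pair C f \<subseteq> kernel_pair C g"
    if fg: "f \<in> Arr C" "g \<in> Arr C" "Dom C f = Dom C g" "kernel_le C f g" "kernel_le C g f" for f g
  proof
    fix m assume m: "m \<in> kernel_pair C f"
    show "m \<in> kernel_pair C g"
    proof (rule kernel_pairI[OF fg(2) kernel_pair_mono[OF fg(1) m]])
      show "Cod C m = sq C (Dom C g)"
        using kernel_pairD[OF m] fg(3) by simp
      fix A u v assume uv: "u \<in> hom C A (Dom C g)" "v \<in> hom C A (Dom C g)"
      note uv' = uv[folded fg(3)]
      show "factors C (pairing C u v) m \<longleftrightarrow> g \<cdot> u = g \<cdot> v"
        unfolding kernel_pair_factors[OF fg(1) m uv']
        by (rule iffI[OF kernel_leD[OF fg(4) uv'] kernel_leD[OF fg(5) uv]])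
    qed
  qed
  show "kernel_pair C f = kernel_pair C g"
    using sub[of f g] sub[of g f] le assms by auto
qed

text \<open>The representatives of the kernel pair of \<open>f\<close> form a whole equivalence class of
  monomorphisms, and the induced relation on generalized elements is equality after composition
  with \<open>f\<close>.\<close>

lemma kernel_pair_EffEq:
  assumes f: "f \<in> Arr C" and X: "Dom C f = X"
  shows "kernel_pair C f \<in> EffEq C X"
proof -
  obtain m where m: "m \<in> kernel_pair C f"
    using kernel_pair_nonempty[OF f] .
  let ?r = "{(m, n). m \<in> monos_into C (sq C X) \<and> n \<in> monos_into C (sq C X) \<and>
    factors C m n \<and> factors C n m}"
  have mono: "n \<in> monos_into C (sq C X)" if "n \<in> kernel_pair C f" for n
    using kernel_pair_mono[OF f that] kernel_pairD[OF that] X by (simp add: monos_into_def)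
  have "kernel_pair C f = ?r `` {m}"
  proof (intro equalityI subsetI)
    fix n assume n: "n \<in> kernel_pair C f"
    then show "n \<in> ?r `` {m}"
      using m mono kernel_pair_factors_iff[OF f f refl] kernel_le_refl by auto
  next
    fix n assume "n \<in> ?r `` {m}"
    then have n: "is_mono C n" "Cod C n = sq C X" "factors C m n" "factors C n m"
      by (auto simp: monos_into_def)
    then have na: "n \<in> Arr C"
      by (simp add: is_mono_def)
    note ma = kernel_pairD(1)[OF m]
    show "n \<in> kernel_pair C f"
    proof (rule kernel_pairI[OF f n(1)])
      show "Cod C n = sq C (Dom C f)"
        using n X by simp
      fix A u v assume "u \<in> hom C A (Dom C f)" "v \<in> hom C A (Dom C f)"
      then show "factors C (pairing C u v) n \<longleftrightarrow> f \<cdot> u = f \<cdot> v"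
        using kernel_pair_factors[OF f m] factors_trans[OF _ n(3) ma na]
          factors_trans[OF _ n(4) na ma] by blast
    qed
  qed
  then have "kernel_pair C f \<in> Sub C (sq C X)"
    using quotientI[OF mono[OF m], of ?r] by (simp only: Sub_def)
  moreover have "equiv (hom C A X) {(x, y). x \<in> hom C A X \<and> y \<in> hom C A X \<and>
      (\<exists>m\<in>kernel_pair C f. factors C (pairing C x y) m)}" for A
  proof -
    have "(\<exists>m\<in>kernel_pair C f. factors C (pairing C x y) m) \<longleftrightarrow> f \<cdot> x = f \<cdot> y"
      if "x \<in> hom C A X" "y \<in> hom C A X" for x y
      using kernel_pair_factors[OF f _ that[folded X]] m by blast
    then have "{(x, y). x \<in> hom C A X \<and> y \<in> hom C A X \<and>
        (\<exists>m\<in>kernel_pair C f. factors C (pairing C x y) m)} =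
      {(x, y). x \<in> hom C A X \<and> y \<in> hom C A X \<and> f \<cdot> x = f \<cdot> y}"
      by blast
    then show ?thesis
      by (auto simp: equiv_def refl_on_def sym_def trans_def)
  qed
  ultimately show ?thesis
    using f X unfolding EffEq_def is_equivalence_relation_def by blast
qed

lemma EffEq_cases:
  assumes "S \<in> EffEq C X"
  obtains f where "f \<in> Arr C" "Dom C f = X" "S = kernel_pair C f"
  using assms unfolding EffEq_def by blast

text \<open>A pair \<open>(u, v)\<close> lies in the inverse image iff \<open>(f \<cdot> u, f \<cdot> v)\<close> lies in the kernel pair of \<open>g\<close>.
  Since the kernel pair of \<open>g \<cdot> f\<close> exists, this also shows that the pullback defining the inverse
  image exists.\<close>

lemma inv_image_kernel_pair:
  assumes f: "f \<in> Arr C" and g: "g \<in> Arr C" and fg: "Cod C f = Dom C g"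
  shows "inv_image_rel C f (kernel_pair C g) = kernel_pair C (g \<cdot> f)"
proof (intro equalityI subsetI)
  let ?X = "Dom C g" and ?Y = "Dom C f"
  have XY: "?X \<in> Ob C" "?Y \<in> Ob C"
    using f g by auto
  have sqf: "sq_arr C f \<in> hom C (sq C ?Y) (sq C ?X)"
    using f fg by (simp add: hom_iff)
  have sqp: "sq_arr C f \<cdot> pairing C u v = pairing C (f \<cdot> u) (f \<cdot> v)"
    if "u \<in> hom C A ?Y" "v \<in> hom C A ?Y" for u v A
  proof (rule square_eqI[of ?X _ A])
    let ?h = "pairing C u v"
    have h: "?h \<in> Arr C" "Dom C ?h = A" "Cod C ?h = sq C ?Y"
      "pr1 C ?Y \<cdot> ?h = u" "pr2 C ?Y \<cdot> ?h = v"
      using pairing[of u v] that by (auto simp: hom_iff)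
    have k: "pairing C (f \<cdot> u) (f \<cdot> v) \<in> hom C A (sq C ?X)"
      "pr1 C ?X \<cdot> pairing C (f \<cdot> u) (f \<cdot> v) = f \<cdot> u" "pr2 C ?X \<cdot> pairing C (f \<cdot> u) (f \<cdot> v) = f \<cdot> v"
      using pairing[of "f \<cdot> u" "f \<cdot> v"] that f fg by (auto simp: hom_iff)
    have "pr1 C ?X \<cdot> (sq_arr C f \<cdot> ?h) = (pr1 C ?X \<cdot> sq_arr C f) \<cdot> ?h"
      "pr2 C ?X \<cdot> (sq_arr C f \<cdot> ?h) = (pr2 C ?X \<cdot> sq_arr C f) \<cdot> ?h"
      using h f fg XY by auto
    moreover have "(f \<cdot> pr1 C ?Y) \<cdot> ?h = f \<cdot> u" "(f \<cdot> pr2 C ?Y) \<cdot> ?h = f \<cdot> v"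
      using h f XY by simp_all
    ultimately show "pr1 C ?X \<cdot> (sq_arr C f \<cdot> ?h) = pr1 C ?X \<cdot> pairing C (f \<cdot> u) (f \<cdot> v)"
      "pr2 C ?X \<cdot> (sq_arr C f \<cdot> ?h) = pr2 C ?X \<cdot> pairing C (f \<cdot> u) (f \<cdot> v)"
      using k(2,3) sq_arr(4,5)[OF f] fg by simp_all
    show "sq_arr C f \<cdot> ?h \<in> hom C A (sq C ?X)" "pairing C (f \<cdot> u) (f \<cdot> v) \<in> hom C A (sq C ?X)"
      using h f fg k by (auto simp: hom_iff)
  qed (use XY in auto)
  {
    fix m assume "m \<in> inv_image_rel C f (kernel_pair C g)"
    then obtain n k where n: "n \<in> kernel_pair C g" and pb: "is_pullback C n (sq_arr C f) k m"
      unfolding inv_image_rel_def pullback_sub_def by blast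
    have nm: "is_mono C n" using kernel_pair_mono[OF g n] .
    have m: "m \<in> Arr C" "Cod C m = sq C ?Y" "k \<in> Arr C" "Dom C k = Dom C m" "Cod C k = Dom C n"
      "n \<cdot> k = sq_arr C f \<cdot> m"
      using pb sqf by (auto simp: is_pullback_def hom_iff)
    have na: "n \<in> Arr C" "Cod C n = sq C ?X"
      using kernel_pairD[OF n] by auto
    show "m \<in> kernel_pair C (g \<cdot> f)"
    proof (rule kernel_pairI)
      show "g \<cdot> f \<in> Arr C" "Cod C m = sq C (Dom C (g \<cdot> f))"
        using f g fg m by auto
      \<comment> \<open>A pullback of the monomorphism \<open>n\<close> is a monomorphism.\<close>
      show "is_mono C m"
        unfolding is_mono_def
      proof (intro conjI ballI impI m)
        fix A u v assume A: "A \<in> Ob C" and uv: "u \<in> hom C A (Dom C m)" "v \<in> hom C A (Dom C m)"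
          and eq: "m \<cdot> u = m \<cdot> v"
        have "n \<cdot> (k \<cdot> u) = (n \<cdot> k) \<cdot> u" "n \<cdot> (k \<cdot> v) = (n \<cdot> k) \<cdot> v"
          using uv m(1-5) na by (auto simp: hom_iff)
        then have "n \<cdot> (k \<cdot> u) = n \<cdot> (k \<cdot> v)"
          using m eq uv sqf by (auto simp: hom_iff)
        moreover have "k \<cdot> u \<in> hom C A (Dom C n)" "k \<cdot> v \<in> hom C A (Dom C n)"
          using uv m by (auto simp: hom_iff)
        ultimately have ku: "k \<cdot> u = k \<cdot> v"
          using nm A unfolding is_mono_def by blast
        have "m \<cdot> u \<in> hom C A (Dom C (sq_arr C f))" "n \<cdot> (k \<cdot> u) = sq_arr C f \<cdot> (m \<cdot> u)"
          using \<open>n \<cdot> (k \<cdot> u) = (n \<cdot> k) \<cdot> u\<close> uv(1) m sqf by (simp_all add: hom_iff)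
        then have "\<exists>!w. w \<in> hom C A (Dom C k) \<and> k \<cdot> w = k \<cdot> u \<and> m \<cdot> w = m \<cdot> u"
          using pb A \<open>k \<cdot> u \<in> hom C A (Dom C n)\<close> unfolding is_pullback_def by blast
        then show "u = v"
          using uv ku eq m(4) by metis
      qed
      fix A u v assume A: "A \<in> Ob C" and "u \<in> hom C A (Dom C (g \<cdot> f))" "v \<in> hom C A (Dom C (g \<cdot> f))"
      then have uv: "u \<in> hom C A ?Y" "v \<in> hom C A ?Y"
        using f g fg by auto
      then have h: "pairing C u v \<in> hom C A (sq C ?Y)"
        using pairing[of u v] by (auto simp: hom_iff)
      have "factors C (pairing C u v) m \<longleftrightarrow> factors C (sq_arr C f \<cdot> pairing C u v) n"
      proof
        assume "factors C (pairing C u v) m"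
        then obtain w where w: "w \<in> hom C A (Dom C m)" "m \<cdot> w = pairing C u v"
          using h by (auto simp: factors_def hom_iff)
        have "n \<cdot> (k \<cdot> w) = (n \<cdot> k) \<cdot> w"
          using w(1) m(1-5) na by (auto simp: hom_iff)
        also have "\<dots> = sq_arr C f \<cdot> pairing C u v"
          using w m sqf by (auto simp: hom_iff)
        finally show "factors C (sq_arr C f \<cdot> pairing C u v) n"
          using w m h sqf unfolding factors_def by (intro bexI[of _ "k \<cdot> w"]) (auto simp: hom_iff)
      next
        assume "factors C (sq_arr C f \<cdot> pairing C u v) n"
        then obtain w where w: "w \<in> hom C A (Dom C n)" "n \<cdot> w = sq_arr C f \<cdot> pairing C u v"
          using h sqf by (auto simp: factors_def hom_iff)
        have "pairing C u v \<in> hom C A (Dom C (sq_arr C f))"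
          using h sqf by (simp add: hom_iff)
        with w A pb have "\<exists>!z. z \<in> hom C A (Dom C k) \<and> k \<cdot> z = w \<and> m \<cdot> z = pairing C u v"
          unfolding is_pullback_def by blast
        then obtain z where "z \<in> hom C A (Dom C k)" "m \<cdot> z = pairing C u v"
          by blast
        then show "factors C (pairing C u v) m"
          using h m(4) unfolding factors_def by (intro bexI[of _ z]) (simp_all add: hom_iff)
      qed
      also have "\<dots> \<longleftrightarrow> g \<cdot> (f \<cdot> u) = g \<cdot> (f \<cdot> v)"
        unfolding sqp[OF uv]
        using uv f fg by - (rule kernel_pair_factors[OF g n, of _ A]; auto simp: hom_iff)
      finally show "factors C (pairing C u v) m \<longleftrightarrow> (g \<cdot> f) \<cdot> u = (g \<cdot> f) \<cdot> v"
        using uv f g fg by (auto simp: hom_iff)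
    qed
  next
    fix m assume m: "m \<in> kernel_pair C (g \<cdot> f)"
    have gf: "g \<cdot> f \<in> Arr C" "Dom C (g \<cdot> f) = ?Y"
      using f g fg by auto
    have ma: "m \<in> Arr C" "Cod C m = sq C ?Y" and mm: "is_mono C m"
      using kernel_pairD[OF m] gf kernel_pair_mono[OF gf(1) m] by auto
    let ?p = "pr1 C ?Y \<cdot> m" and ?q = "pr2 C ?Y \<cdot> m"
    have pq: "?p \<in> hom C (Dom C m) ?Y" "?q \<in> hom C (Dom C m) ?Y"
      using ma XY by (auto simp: hom_iff)
    have meq: "pairing C ?p ?q = m"
      by (rule pairing_projections[OF ma XY(2)])
    obtain n where n: "n \<in> kernel_pair C g"
      using kernel_pair_nonempty[OF g] .
    have na: "n \<in> Arr C" "Cod C n = sq C ?X" and nm: "is_mono C n"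
      using kernel_pairD[OF n] kernel_pair_mono[OF g n] by auto
    have "g \<cdot> (f \<cdot> ?p) = g \<cdot> (f \<cdot> ?q)"
      using kernel_pairD(3)[OF m] gf pq f g fg by (auto simp: hom_iff)
    then have "factors C (pairing C (f \<cdot> ?p) (f \<cdot> ?q)) n"
      using pq f fg kernel_pair_factors[OF g n, of "f \<cdot> ?p" "Dom C m" "f \<cdot> ?q"] by (auto simp: hom_iff)
    then have "factors C (sq_arr C f \<cdot> m) n"
      using sqp[OF pq] meq by simp
    then obtain k where k: "k \<in> hom C (Dom C m) (Dom C n)" "n \<cdot> k = sq_arr C f \<cdot> m"
      using ma sqf by (auto simp: factors_def hom_iff)
    have "is_pullback C n (sq_arr C f) k m"
      unfolding is_pullback_def
    proof (intro conjI ballI impI)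
      fix A a b assume A: "A \<in> Ob C" and a: "a \<in> hom C A (Dom C n)"
        and "b \<in> hom C A (Dom C (sq_arr C f))" and eq: "n \<cdot> a = sq_arr C f \<cdot> b"
      then have b: "b \<in> hom C A (sq C ?Y)"
        using sqf by (simp add: hom_iff)
      let ?u = "pr1 C ?Y \<cdot> b" and ?v = "pr2 C ?Y \<cdot> b"
      have uv: "?u \<in> hom C A ?Y" "?v \<in> hom C A ?Y"
        using b XY by (auto simp: hom_iff)
      have beq: "pairing C ?u ?v = b"
        using b XY by - (rule pairing_projections; auto simp: hom_iff)
      have "factors C (sq_arr C f \<cdot> b) n"
        using a eq b sqf unfolding factors_def by (intro bexI[of _ a]) (auto simp: hom_iff)
      then have "factors C (pairing C (f \<cdot> ?u) (f \<cdot> ?v)) n"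
        using sqp[OF uv] beq by simp
      then have "g \<cdot> (f \<cdot> ?u) = g \<cdot> (f \<cdot> ?v)"
        using uv f fg kernel_pair_factors[OF g n, of "f \<cdot> ?u" A "f \<cdot> ?v"] by (auto simp: hom_iff)
      then have "(g \<cdot> f) \<cdot> ?u = (g \<cdot> f) \<cdot> ?v"
        using uv f g fg by (auto simp: hom_iff)
      then have "factors C b m"
        using kernel_pair_factors[OF gf(1) m, of ?u A ?v] uv gf beq by simp
      then obtain w where w: "w \<in> hom C A (Dom C m)" "m \<cdot> w = b"
        using b by (auto simp: factors_def hom_iff)
      have "n \<cdot> (k \<cdot> w) = (n \<cdot> k) \<cdot> w"
        using w(1) k(1) na by (auto simp: hom_iff)
      also have "\<dots> = n \<cdot> a"
        using w k ma sqf eq by (auto simp: hom_iff)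
      finally have "n \<cdot> (k \<cdot> w) = n \<cdot> a" .
      moreover have "k \<cdot> w \<in> hom C A (Dom C n)"
        using w k by (auto simp: hom_iff)
      ultimately have kw: "k \<cdot> w = a"
        using nm a A unfolding is_mono_def by blast
      show "\<exists>!z. z \<in> hom C A (Dom C k) \<and> k \<cdot> z = a \<and> m \<cdot> z = b"
      proof (rule ex1I[of _ w])
        show "w \<in> hom C A (Dom C k) \<and> k \<cdot> w = a \<and> m \<cdot> w = b"
          using w kw k by (auto simp: hom_iff)
        fix z assume "z \<in> hom C A (Dom C k) \<and> k \<cdot> z = a \<and> m \<cdot> z = b"
        then have "z \<in> hom C A (Dom C m)" "m \<cdot> z = m \<cdot> w"
          using w k by (auto simp: hom_iff)
        then show "z = w"
          using mm w A unfolding is_mono_def by blast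
      qed
    qed (use na sqf k ma in \<open>auto simp: hom_iff\<close>)
    then show "m \<in> inv_image_rel C f (kernel_pair C g)"
      using n unfolding inv_image_rel_def pullback_sub_def by blast
  }
qed

end

section \<open>Reflections of quotients\<close>

text \<open>The arrow \<open>r\<close> is weakly initial among the arrows from \<open>X\<close> to an object of \<open>B\<close> whose kernel
  pair contains that of \<open>g : X \<rightarrow> Y\<close>. If \<open>B\<close> spans an epireflective subcategory, the quotient map of
  \<open>X\<close> by the kernel pair of \<open>g\<close>, followed by the unit at the quotient, is such an arrow.\<close>

definition is_quotient_reflection ::
    "('o, 'a) category \<Rightarrow> 'o set \<Rightarrow> 'a \<Rightarrow> 'a \<Rightarrow> bool" where
  "is_quotient_reflection C B g r \<longleftrightarrow>
     r \<in> Arr C \<and> Dom C r = Dom C g \<and> Cod C r \<in> B \<and> kernel_le C g r \<and>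
     (\<forall>h\<in>Arr C. Dom C h = Dom C g \<and> Cod C h \<in> B \<and> kernel_le C g h \<longrightarrow>
        (\<exists>k\<in>hom C (Cod C r) (Cod C h). k \<cdot>\<^bsub>C\<^esub> r = h))"

text \<open>The choices of \<open>g\<close> and \<open>r\<close> do not affect the value: any two weakly initial arrows factor
  through each other and so have the same kernel pair.\<close>

definition reflection_closure ::
    "('o, 'a) category \<Rightarrow> 'o set \<Rightarrow> 'o \<Rightarrow> 'a set \<Rightarrow> 'a set" where
  "reflection_closure C B = (\<lambda>X\<in>Ob C. \<lambda>S\<in>EffEq C X. kernel_pair C
     (SOME r. \<exists>g\<in>Arr C. Dom C g = X \<and> S = kernel_pair C g \<and> is_quotient_reflection C B g r))"

context category
begin

lemma quotient_reflectionD: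
  assumes "is_quotient_reflection C B g r"
  shows "r \<in> Arr C" "Dom C r = Dom C g" "Cod C r \<in> B" "kernel_le C g r"
  using assms unfolding is_quotient_reflection_def by blast+

lemma quotient_reflection_factor:
  assumes "is_quotient_reflection C B g r"
    and "h \<in> Arr C" "Dom C h = Dom C g" "Cod C h \<in> B" "kernel_le C g h"
  obtains k where "k \<in> hom C (Cod C r) (Cod C h)" "k \<cdot> r = h"
  using assms unfolding is_quotient_reflection_def by blast

lemma quotient_reflection_kernel_le:
  assumes r: "is_quotient_reflection C B g r"
    and h: "h \<in> Arr C" "Dom C h = Dom C g" "Cod C h \<in> B" "kernel_le C g h"
  shows "kernel_le C r h"
proof -
  obtain k where k: "k \<in> hom C (Cod C r) (Cod C h)" "k \<cdot> r = h"
    using quotient_reflection_factor[OF assms] .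
  have "kernel_le C r (k \<cdot> r)"
    using kernel_le_comp[of r k] quotient_reflectionD(1)[OF r] k(1) by (simp add: hom_iff)
  then show ?thesis
    by (simp only: k(2))
qed

end

context regular_category
begin

lemma reflection_closure_kernel_pair:
  assumes g: "g \<in> Arr C" and r: "is_quotient_reflection C B g r"
  shows "reflection_closure C B (Dom C g) (kernel_pair C g) = kernel_pair C r"
proof -
  let ?P = "\<lambda>r'. \<exists>g'\<in>Arr C. Dom C g' = Dom C g \<and> kernel_pair C g = kernel_pair C g' \<and>
    is_quotient_reflection C B g' r'"
  define r' where "r' = (SOME r'. ?P r')"
  have "?P r"
    using g r by blast
  then have "?P r'"
    unfolding r'_def by (rule someI)
  then obtain g' where g': "g' \<in> Arr C" "Dom C g' = Dom C g" "kernel_pair C g = kernel_pair C g'"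
    and r': "is_quotient_reflection C B g' r'"
    by blast
  have le: "kernel_le C g g'" "kernel_le C g' g"
    using kernel_pair_eq_iff[of g g'] g g' by auto
  note rD = quotient_reflectionD[OF r] and rD' = quotient_reflectionD[OF r']
  have "kernel_le C g r'" "kernel_le C g' r"
    using kernel_le_trans[OF le(1) rD'(4)] kernel_le_trans[OF le(2) rD(4)] g'(2) by simp_all
  then have "kernel_le C r r'" "kernel_le C r' r"
    using quotient_reflection_kernel_le[OF r rD'(1) _ rD'(3)]
      quotient_reflection_kernel_le[OF r' rD(1) _ rD(3)] rD(2) rD'(2) g'(2) by simp_all
  then have "kernel_pair C r' = kernel_pair C r"
    using kernel_pair_eq_iff[of r' r] rD rD' g'(2) by simp
  moreover have "reflection_closure C B (Dom C g) (kernel_pair C g) = kernel_pair C r'"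
    using g kernel_pair_EffEq[OF g refl] unfolding reflection_closure_def r'_def by simp
  ultimately show ?thesis
    by simp
qed

text \<open>The kernel pair of \<open>g \<cdot> f\<close> is the inverse image of that of \<open>g\<close>. If \<open>f\<close> is a regular
  epimorphism, every arrow that identifies this inverse image factors through \<open>f\<close>, and the factor
  identifies the kernel pair of \<open>g\<close>; so the quotients have the same reflection.\<close>

lemma quotient_reflection_precomp:
  assumes r: "is_quotient_reflection C B g r" and g: "g \<in> Arr C"
    and f: "is_regular_epi C f" "Cod C f = Dom C g"
  shows "is_quotient_reflection C B (g \<cdot> f) (r \<cdot> f)"
  unfolding is_quotient_reflection_def
proof (intro conjI ballI impI)
  note rD = quotient_reflectionD[OF r]
  have fa: "f \<in> Arr C"
    by (rule regular_epiD(1)[OF f(1)])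
  show "r \<cdot> f \<in> Arr C" "Dom C (r \<cdot> f) = Dom C (g \<cdot> f)" "Cod C (r \<cdot> f) \<in> B"
    using rD(1-3) g fa f(2) by simp_all
  show "kernel_le C (g \<cdot> f) (r \<cdot> f)"
    using kernel_le_precomp[OF rD(4) fa g rD(1) f(2)] rD(2) f(2) by simp
  fix h assume h: "h \<in> Arr C" and "Dom C h = Dom C (g \<cdot> f) \<and> Cod C h \<in> B \<and> kernel_le C (g \<cdot> f) h"
  then have dom: "Dom C h = Dom C f" and cod: "Cod C h \<in> B" and le: "kernel_le C (g \<cdot> f) h"
    using fa g f(2) by simp_all
  have "kernel_le C f h"
    using kernel_le_trans[OF kernel_le_comp[OF fa g f(2)] le] fa g f(2) by simp
  then obtain k where k: "k \<in> hom C (Cod C f) (Cod C h)" "k \<cdot> f = h"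
    using regular_epi_factor[OF f(1) h dom] by blast
  have ka: "k \<in> Arr C" "Dom C k = Dom C g" "Cod C k = Cod C h"
    using k(1) f(2) by (simp_all add: hom_iff)
  have "kernel_le C g k"
    using kernel_le_cancel[OF f(1) g _ ka(1)] le k(2) ka(2) f(2) by simp
  then obtain l where l: "l \<in> hom C (Cod C r) (Cod C k)" "l \<cdot> r = k"
    using quotient_reflection_factor[OF r ka(1,2)] cod ka(3) by metis
  have "l \<cdot> (r \<cdot> f) = (l \<cdot> r) \<cdot> f"
    using l(1) fa rD(1,2) f(2) by (simp add: hom_iff)
  then show "\<exists>k\<in>hom C (Cod C (r \<cdot> f)) (Cod C h). k \<cdot> (r \<cdot> f) = h"
    using l k(2) ka(3) fa rD(1,2) f(2) by (intro bexI[of _ l]) simp_all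
qed

text \<open>Each axiom is checked on arrows \<open>g\<close> and \<open>r\<close> with \<open>S = kernel_pair C g\<close> and closure
  \<open>kernel_pair C r\<close>. For continuity along \<open>f\<close>, the arrow \<open>r \<cdot> f\<close> ends in \<open>B\<close> and identifies the
  inverse image of \<open>S\<close>, so the closure of this inverse image lies below the kernel pair of
  \<open>r \<cdot> f\<close>.\<close>

lemma reflection_closure_effective:
  assumes refl: "\<And>g. g \<in> Arr C \<Longrightarrow> \<exists>r. is_quotient_reflection C B g r"
  shows "reflection_closure C B \<in> effective_closure_operators C"
proof -
  let ?cl = "reflection_closure C B"
  have cl: "\<exists>g r. g \<in> Arr C \<and> Dom C g = X \<and> S = kernel_pair C g \<and> is_quotient_reflection C B g r \<and>
      ?cl X S = kernel_pair C r" if S: "S \<in> EffEq C X" for X S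
  proof -
    obtain g where "g \<in> Arr C" "Dom C g = X" "S = kernel_pair C g"
      using EffEq_cases[OF S] .
    then show ?thesis
      using refl reflection_closure_kernel_pair by blast
  qed
  have EffEq: "?cl X S \<in> EffEq C X" if "S \<in> EffEq C X" for X S
    using cl[OF that] kernel_pair_EffEq quotient_reflectionD(1,2) by metis
  have "?cl \<in> (\<Pi>\<^sub>E X\<in>Ob C. EffEq C X \<rightarrow>\<^sub>E EffEq C X)"
  proof (intro PiE_I)
    fix X S assume "X \<in> Ob C" "S \<in> EffEq C X"
    then show "?cl X S \<in> EffEq C X"
      by (rule_tac EffEq)
  qed (simp_all add: reflection_closure_def)
  moreover have "sub_le C S (?cl X S)" if S: "S \<in> EffEq C X" for X S
  proof -
    obtain g r where "g \<in> Arr C" "S = kernel_pair C g" "is_quotient_reflection C B g r"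
      "?cl X S = kernel_pair C r"
      using cl[OF S] by blast
    then show ?thesis
      using sub_le_kernel_pair[of g r] quotient_reflectionD[of B g r] by simp
  qed
  moreover have "sub_le C (?cl X S) (?cl X T)"
    if S: "S \<in> EffEq C X" and T: "T \<in> EffEq C X" and le: "sub_le C S T" for X S T
  proof -
    obtain g r where g: "g \<in> Arr C" "Dom C g = X" "S = kernel_pair C g"
      "is_quotient_reflection C B g r" "?cl X S = kernel_pair C r"
      using cl[OF S] by blast
    obtain h t where h: "h \<in> Arr C" "Dom C h = X" "T = kernel_pair C h"
      "is_quotient_reflection C B h t" "?cl X T = kernel_pair C t"
      using cl[OF T] by blast
    note rD = quotient_reflectionD[OF g(4)] and tD = quotient_reflectionD[OF h(4)]
    have "kernel_le C g h"
      using sub_le_kernel_pair[of g h] g h le by simp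
    then have "kernel_le C g t"
      using kernel_le_trans[OF _ tD(4)] g(2) h(2) by simp
    then have "kernel_le C r t"
      using quotient_reflection_kernel_le[OF g(4) tD(1) _ tD(3)] tD(2) g(2) h(2) by simp
    then show ?thesis
      using sub_le_kernel_pair[OF rD(1) tD(1)] rD(2) tD(2) g h by simp
  qed
  moreover have "sub_le C (?cl Y (inv_image_rel C f S)) (inv_image_rel C f (?cl X S)) \<and>
    (is_regular_epi C f \<longrightarrow> ?cl Y (inv_image_rel C f S) = inv_image_rel C f (?cl X S))"
    if f: "f \<in> hom C Y X" and S: "S \<in> EffEq C X" for X Y f S
  proof -
    obtain g r where g: "g \<in> Arr C" "Dom C g = X" "S = kernel_pair C g"
      "is_quotient_reflection C B g r" "?cl X S = kernel_pair C r"
      using cl[OF S] by blast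
    have fa: "f \<in> Arr C" "Dom C f = Y" "Cod C f = Dom C g"
      using f g(2) by (simp_all add: hom_iff)
    note rD = quotient_reflectionD[OF g(4)]
    have gf: "g \<cdot> f \<in> Arr C" "Dom C (g \<cdot> f) = Y" and rf: "r \<cdot> f \<in> Arr C" "Dom C (r \<cdot> f) = Y" "Cod C (r \<cdot> f) \<in> B"
      using fa g rD(1-3) by simp_all
    have inv: "inv_image_rel C f S = kernel_pair C (g \<cdot> f)"
      "inv_image_rel C f (?cl X S) = kernel_pair C (r \<cdot> f)"
      using inv_image_kernel_pair[OF fa(1)] g rD(1,2) fa by simp_all
    obtain t where t: "is_quotient_reflection C B (g \<cdot> f) t"
      using refl[OF gf(1)] by blast
    note tD = quotient_reflectionD[OF t]
    have clt: "?cl Y (inv_image_rel C f S) = kernel_pair C t"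
      using reflection_closure_kernel_pair[OF gf(1) t] gf(2) inv by simp
    have "kernel_le C (g \<cdot> f) (r \<cdot> f)"
      using kernel_le_precomp[OF rD(4) fa(1) g(1) rD(1) fa(3)] rD(2) fa(3) by simp
    then have "kernel_le C t (r \<cdot> f)"
      using quotient_reflection_kernel_le[OF t rf(1) _ rf(3)] rf(2) gf(2) by simp
    then have "sub_le C (kernel_pair C t) (kernel_pair C (r \<cdot> f))"
      using sub_le_kernel_pair[OF tD(1) rf(1)] tD(2) gf(2) rf(2) by simp
    moreover have "?cl Y (inv_image_rel C f S) = kernel_pair C (r \<cdot> f)" if "is_regular_epi C f"
      using reflection_closure_kernel_pair[OF gf(1) quotient_reflection_precomp[OF g(4,1) that fa(3)]]
        gf(2) inv by simp
    ultimately show ?thesis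
      using clt inv by simp
  qed
  moreover have "?cl X (?cl X S) = ?cl X S" if S: "S \<in> EffEq C X" for X S
  proof -
    obtain g r where g: "g \<in> Arr C" "Dom C g = X" "S = kernel_pair C g"
      "is_quotient_reflection C B g r" "?cl X S = kernel_pair C r"
      using cl[OF S] by blast
    note rD = quotient_reflectionD[OF g(4)]
    \<comment> \<open>An arrow that identifies the closure identifies \<open>S\<close>, so \<open>r\<close> is also the reflection of
      the quotient by the closure.\<close>
    have "is_quotient_reflection C B r r"
      unfolding is_quotient_reflection_def
    proof (intro conjI ballI impI)
      fix h assume h: "h \<in> Arr C" "Dom C h = Dom C r \<and> Cod C h \<in> B \<and> kernel_le C r h"
      then have "kernel_le C g h"
        using kernel_le_trans[OF rD(4)] rD(2) by simp
      then obtain k where "k \<in> hom C (Cod C r) (Cod C h)" "k \<cdot> r = h"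
        using quotient_reflection_factor[OF g(4) h(1)] h(2) rD(2) by metis
      then show "\<exists>k\<in>hom C (Cod C r) (Cod C h). k \<cdot> r = h"
        by blast
    qed (use rD kernel_le_refl in simp_all)
    then show ?thesis
      using reflection_closure_kernel_pair[OF rD(1)] rD(2) g by simp
  qed
  ultimately show ?thesis
    unfolding effective_closure_operators_def idempotent_closure_operator_def by blast
qed

section \<open>From epireflective subcategories to closure operators\<close>

lemma subcat_simps [simp]:
  "Ob (subcat C L) = fst L" "Arr (subcat C L) = snd L" "Dom (subcat C L) = Dom C"
  "Cod (subcat C L) = Cod C" "Idn (subcat C L) = Idn C" "Comp (subcat C L) = Comp C"
  by (simp_all add: subcat_def)

lemma epireflective_arrows:
  assumes "L \<in> epireflective_subcategories C"
  shows "fst L \<subseteq> Ob C" "snd L = {f \<in> Arr C. Dom C f \<in> fst L \<and> Cod C f \<in> fst L}"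
proof -
  have sub: "fst L \<subseteq> Ob C" "snd L \<subseteq> Arr C" "category (subcat C L)" and full: "is_full C L"
    using assms by (auto simp: epireflective_subcategories_def is_subcategory_def)
  show "fst L \<subseteq> Ob C"
    by (rule sub)
  show "snd L = {f \<in> Arr C. Dom C f \<in> fst L \<and> Cod C f \<in> fst L}"
  proof (intro equalityI subsetI)
    fix f assume "f \<in> snd L"
    then show "f \<in> {f \<in> Arr C. Dom C f \<in> fst L \<and> Cod C f \<in> fst L}"
      using sub(2) category.Dom_in_Ob[OF sub(3), of f] category.Cod_in_Ob[OF sub(3), of f] by auto
  next
    fix f assume "f \<in> {f \<in> Arr C. Dom C f \<in> fst L \<and> Cod C f \<in> fst L}"
    then show "f \<in> snd L"
      using full unfolding is_full_def hom_def by blast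
  qed
qed

lemma epireflective_reflection:
  assumes L: "L \<in> epireflective_subcategories C" and A: "A \<in> Ob C"
  obtains e where "is_regular_epi C e" "Dom C e = A" "Cod C e \<in> fst L"
    and "\<And>f. f \<in> Arr C \<Longrightarrow> Dom C f = A \<Longrightarrow> Cod C f \<in> fst L \<Longrightarrow> \<exists>k\<in>hom C (Cod C e) (Cod C f). k \<cdot> e = f"
proof -
  obtain R \<eta> where adj: "is_left_adjoint C (subcat C L) R id_functor \<eta>"
    and epi: "\<forall>A\<in>Ob C. is_regular_epi C (\<eta> A)"
    using L unfolding epireflective_subcategories_def by blast
  have \<eta>: "\<eta> A \<in> hom C A (on_ob R A)" and R: "on_ob R A \<in> fst L"
    using adj A by (auto simp: is_left_adjoint_def is_nat_trans_def is_functor_def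
      id_functor_def comp_functor_def)
  let ?I = "id_functor :: ('a, 'b, 'a, 'b) fnctr"
  have univ: "\<forall>A\<in>Ob C. \<forall>B\<in>Ob (subcat C L). \<forall>f\<in>hom C A (on_ob ?I B).
      \<exists>!g. g \<in> hom (subcat C L) (on_ob R A) B \<and> on_arr ?I g \<cdot> \<eta> A = f"
    using adj unfolding is_left_adjoint_def by (elim conjE)
  have "\<exists>k\<in>hom C (Cod C (\<eta> A)) (Cod C f). k \<cdot> \<eta> A = f"
    if f: "f \<in> Arr C" "Dom C f = A" "Cod C f \<in> fst L" for f
  proof -
    have fh: "f \<in> hom C A (on_ob ?I (Cod C f))"
      using f by (simp add: id_functor_def hom_iff)
    have cod: "Cod C f \<in> Ob (subcat C L)"
      using f(3) by simp
    have "\<exists>!g. g \<in> hom (subcat C L) (on_ob R A) (Cod C f) \<and> on_arr ?I g \<cdot> \<eta> A = f"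
      by (rule univ[rule_format, OF A cod fh])
    then obtain g where "g \<in> hom (subcat C L) (on_ob R A) (Cod C f)" "on_arr ?I g \<cdot> \<eta> A = f"
      by (elim ex1E conjE)
    then have "g \<in> hom (subcat C L) (on_ob R A) (Cod C f)" "g \<cdot> \<eta> A = f"
      by (simp_all only: id_functor_def fnctr.simps)
    moreover have "snd L \<subseteq> Arr C"
      using epireflective_arrows(2)[OF L] by auto
    ultimately show ?thesis
      using \<eta> by (intro bexI[of _ g]) (auto simp: hom_iff)
  qed
  then show ?thesis
    using \<eta> R epi A by (intro that[of "\<eta> A"]) (auto simp: hom_iff)
qed

lemma epireflective_quotient_reflection:
  assumes L: "L \<in> epireflective_subcategories C" and g: "g \<in> Arr C"
  shows "\<exists>r. is_quotient_reflection C (fst L) g r"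
proof -
  obtain q where q: "is_regular_epi C q" "Dom C q = Dom C g" "kernel_le C g q" "kernel_le C q g"
    using quotient_exists[OF g] .
  have qa: "q \<in> Arr C"
    by (rule regular_epiD(1)[OF q(1)])
  obtain e where e: "is_regular_epi C e" "Dom C e = Cod C q" "Cod C e \<in> fst L"
    and univ: "\<And>f. f \<in> Arr C \<Longrightarrow> Dom C f = Cod C q \<Longrightarrow> Cod C f \<in> fst L \<Longrightarrow>
      \<exists>k\<in>hom C (Cod C e) (Cod C f). k \<cdot> e = f"
    using epireflective_reflection[OF L, of "Cod C q"] qa by (metis dom_cod_ob(2))
  have ea: "e \<in> Arr C"
    by (rule regular_epiD(1)[OF e(1)])
  have eq: "Dom C (e \<cdot> q) = Dom C g" "Cod C (e \<cdot> q) = Cod C e" "e \<cdot> q \<in> Arr C"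
    using ea qa e(2) q(2) by simp_all
  have "is_quotient_reflection C (fst L) g (e \<cdot> q)"
    unfolding is_quotient_reflection_def
  proof (intro conjI ballI impI)
    show "kernel_le C g (e \<cdot> q)"
      using kernel_le_trans[OF q(3) kernel_le_comp[OF qa ea]] e(2) q(2) by simp
    fix h assume h: "h \<in> Arr C" "Dom C h = Dom C g \<and> Cod C h \<in> fst L \<and> kernel_le C g h"
    then have "kernel_le C q h"
      using kernel_le_trans[OF q(4)] q(2) by simp
    then obtain k where k: "k \<in> hom C (Cod C q) (Cod C h)" "k \<cdot> q = h"
      using regular_epi_factor[OF q(1) h(1)] h(2) q(2) by metis
    then obtain l where l: "l \<in> hom C (Cod C e) (Cod C k)" "l \<cdot> e = k"
      using univ[of k] h(2) by (auto simp: hom_iff)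
    have "l \<cdot> (e \<cdot> q) = (l \<cdot> e) \<cdot> q"
      using l(1) ea qa e(2) by (simp add: hom_iff)
    then show "\<exists>k\<in>hom C (Cod C (e \<cdot> q)) (Cod C h). k \<cdot> (e \<cdot> q) = h"
      using l k eq(2) by (intro bexI[of _ l]) (simp_all add: hom_iff)
  qed (use eq e(3) in simp_all)
  then show ?thesis
    by blast
qed

end

text \<open>The kernel pair of the identity is the diagonal, the least effective equivalence
  relation.\<close>

definition closed_objects :: "('o, 'a) category \<Rightarrow> ('o \<Rightarrow> 'a set \<Rightarrow> 'a set) \<Rightarrow> 'o set" where
  "closed_objects C cl =
     {A \<in> Ob C. cl A (kernel_pair C (Idn C A)) = kernel_pair C (Idn C A)}"

context category
begin

lemma kernel_le_Idn: "X \<in> Ob C \<Longrightarrow> f \<in> Arr C \<Longrightarrow> Dom C f = X \<Longrightarrow> kernel_le C (Idn C X) f"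
  by (rule kernel_leI) (simp add: hom_iff)

end

context regular_category
begin

text \<open>The closure of the diagonal of \<open>A\<close> is the kernel pair of the unit at \<open>A\<close>. As the unit is a
  regular epimorphism, this is the diagonal exactly if the unit is invertible. Hence the closure
  operator determines the subcategory.\<close>

lemma closed_objects_reflection_closure:
  assumes L: "L \<in> epireflective_subcategories C"
  shows "closed_objects C (reflection_closure C (fst L)) = fst L"
proof -
  have "reflection_closure C (fst L) A (kernel_pair C (Idn C A)) = kernel_pair C (Idn C A) \<longleftrightarrow>
    A \<in> fst L" if A: "A \<in> Ob C" for A
  proof
    let ?cl = "reflection_closure C (fst L)" and ?\<Delta> = "kernel_pair C (Idn C A)"
    {
      assume "A \<in> fst L"
      then have "is_quotient_reflection C (fst L) (Idn C A) (Idn C A)"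
        unfolding is_quotient_reflection_def
        using A kernel_le_refl by (auto simp: hom_iff)
      then show "?cl A ?\<Delta> = ?\<Delta>"
        using reflection_closure_kernel_pair[of "Idn C A"] A by simp
    next
      assume closed: "?cl A ?\<Delta> = ?\<Delta>"
      obtain e where e: "is_regular_epi C e" "Dom C e = A" "Cod C e \<in> fst L"
        and univ: "\<And>f. f \<in> Arr C \<Longrightarrow> Dom C f = A \<Longrightarrow> Cod C f \<in> fst L \<Longrightarrow>
          \<exists>k\<in>hom C (Cod C e) (Cod C f). k \<cdot> e = f"
        using epireflective_reflection[OF L A] by metis
      have ea: "e \<in> Arr C"
        by (rule regular_epiD(1)[OF e(1)])
      have "is_quotient_reflection C (fst L) (Idn C A) e"
        unfolding is_quotient_reflection_def
        using A e ea univ kernel_le_Idn[OF A ea e(2)] by simp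
      then have "?\<Delta> = kernel_pair C e"
        using reflection_closure_kernel_pair[of "Idn C A"] A closed by simp
      then have "kernel_le C e (Idn C A)"
        using kernel_pair_eq_iff[of "Idn C A" e] A ea e(2) by simp
      then have "is_iso C e"
        using regular_epi_kernel_trivial_iso[OF e(1)] e(2) by simp
      then obtain k where k: "k \<in> hom C (Cod C e) A" "k \<cdot> e = Idn C A" "e \<cdot> k = Idn C (Cod C e)"
        using e(2) by (auto simp: is_iso_def)
      have "is_iso C k"
        using k ea e(2) unfolding is_iso_def by (intro conjI bexI[of _ e]) (simp_all add: hom_iff)
      moreover have "is_replete C L"
        using L by (simp add: epireflective_subcategories_def)
      ultimately show "A \<in> fst L"
        using k(1) e(3) by (auto simp: is_replete_def hom_iff)
    }
  qed
  then show ?thesis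
    using epireflective_arrows(1)[OF L] by (auto simp: closed_objects_def)
qed

section \<open>From closure operators to epireflective subcategories\<close>

lemma effective_closureD:
  assumes "cl \<in> effective_closure_operators C"
  shows "cl \<in> (\<Pi>\<^sub>E X\<in>Ob C. EffEq C X \<rightarrow>\<^sub>E EffEq C X)"
    and "X \<in> Ob C \<Longrightarrow> S \<in> EffEq C X \<Longrightarrow> T \<in> EffEq C X \<Longrightarrow> sub_le C S T \<Longrightarrow> sub_le C (cl X S) (cl X T)"
    and "f \<in> hom C Y X \<Longrightarrow> S \<in> EffEq C X \<Longrightarrow>
      sub_le C (cl Y (inv_image_rel C f S)) (inv_image_rel C f (cl X S))"
    and "X \<in> Ob C \<Longrightarrow> S \<in> EffEq C X \<Longrightarrow> cl X (cl X S) = cl X S"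
    and "f \<in> hom C Y X \<Longrightarrow> S \<in> EffEq C X \<Longrightarrow> is_regular_epi C f \<Longrightarrow>
      cl Y (inv_image_rel C f S) = inv_image_rel C f (cl X S)"
proof -
  have ob: "X \<in> Ob C \<and> Y \<in> Ob C" if "f \<in> hom C Y X" for f
    using that by (auto simp: hom_iff)
  note d = assms[unfolded effective_closure_operators_def idempotent_closure_operator_def mem_Collect_eq]
  show "cl \<in> (\<Pi>\<^sub>E X\<in>Ob C. EffEq C X \<rightarrow>\<^sub>E EffEq C X)"
    using d by blast
  show "X \<in> Ob C \<Longrightarrow> S \<in> EffEq C X \<Longrightarrow> T \<in> EffEq C X \<Longrightarrow> sub_le C S T \<Longrightarrow> sub_le C (cl X S) (cl X T)"
    using d by blast
  show "f \<in> hom C Y X \<Longrightarrow> S \<in> EffEq C X \<Longrightarrow>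
      sub_le C (cl Y (inv_image_rel C f S)) (inv_image_rel C f (cl X S))"
    using d ob by blast
  show "X \<in> Ob C \<Longrightarrow> S \<in> EffEq C X \<Longrightarrow> cl X (cl X S) = cl X S"
    using d by blast
  show "f \<in> hom C Y X \<Longrightarrow> S \<in> EffEq C X \<Longrightarrow> is_regular_epi C f \<Longrightarrow>
      cl Y (inv_image_rel C f S) = inv_image_rel C f (cl X S)"
    using d ob by blast
qed

text \<open>An arrow \<open>f\<close> to a closed object exhibits its kernel pair as an inverse image of a closed
  diagonal, so this kernel pair is closed and contains the closure of every relation below it.\<close>

lemma closure_le_kernel_pair:
  assumes cl: "cl \<in> effective_closure_operators C"
    and g: "g \<in> Arr C" and f: "f \<in> Arr C" "Dom C f = Dom C g" "Cod C f \<in> closed_objects C cl"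
    and le: "kernel_le C g f"
    and d: "d \<in> Arr C" "Dom C d = Dom C g" "cl (Dom C g) (kernel_pair C g) = kernel_pair C d"
  shows "kernel_le C d f"
proof -
  let ?X = "Dom C g" and ?A = "Cod C f"
  note clD = effective_closureD[OF cl]
  have XA: "?X \<in> Ob C" "?A \<in> Ob C"
    using g f by simp_all
  have "cl ?X (kernel_pair C f) \<in> EffEq C ?X"
    using clD(1) XA kernel_pair_EffEq[OF f(1,2)] by blast
  then obtain t where t: "t \<in> Arr C" "Dom C t = ?X" "cl ?X (kernel_pair C f) = kernel_pair C t"
    by (rule EffEq_cases)
  have "sub_le C (cl ?X (kernel_pair C g)) (cl ?X (kernel_pair C f))"
    using clD(2)[OF XA(1) kernel_pair_EffEq[OF g refl] kernel_pair_EffEq[OF f(1,2)]]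
      sub_le_kernel_pair[OF g f(1)] le f(2) by simp
  then have dt: "kernel_le C d t"
    using sub_le_kernel_pair[OF d(1) t(1)] d t by simp
  have inv: "inv_image_rel C f (kernel_pair C (Idn C ?A)) = kernel_pair C f"
    using inv_image_kernel_pair[of f "Idn C ?A"] f XA by simp
  have "sub_le C (cl ?X (inv_image_rel C f (kernel_pair C (Idn C ?A))))
      (inv_image_rel C f (cl ?A (kernel_pair C (Idn C ?A))))"
    using clD(3)[of f ?X ?A] f(1,2) kernel_pair_EffEq[of "Idn C ?A" ?A] XA by (simp add: hom_iff)
  then have "sub_le C (kernel_pair C t) (kernel_pair C f)"
    using f(3) t(3) inv by (simp add: closed_objects_def)
  then have "kernel_le C t f"
    using sub_le_kernel_pair[OF t(1) f(1)] t f by simp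
  then show ?thesis
    using kernel_le_trans[OF dt] d t by simp
qed

text \<open>The reflection of \<open>X\<close> is the quotient \<open>e\<close> by the closure of the diagonal. Its codomain is
  closed: if \<open>d\<close> has the closure of the diagonal of the codomain as kernel pair, then the inverse
  image of this closure along \<open>e\<close> is the closure of the kernel pair of \<open>e\<close>, which is the kernel
  pair of \<open>e\<close> by idempotence. So \<open>d \<cdot> e\<close> and \<open>e\<close> have the same kernel pair, and \<open>e\<close> can be
  cancelled.\<close>

lemma closure_diagonal_quotient:
  assumes cl: "cl \<in> effective_closure_operators C" and X: "X \<in> Ob C"
  obtains e where "is_regular_epi C e" "Dom C e = X" "Cod C e \<in> closed_objects C cl"
    "cl X (kernel_pair C (Idn C X)) = kernel_pair C e"
proof -
  note clD = effective_closureD[OF cl]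
  let ?\<Delta> = "\<lambda>X. kernel_pair C (Idn C X)"
  have \<Delta>: "?\<Delta> X \<in> EffEq C X" if "X \<in> Ob C" for X
    using kernel_pair_EffEq that by simp
  have "cl X (?\<Delta> X) \<in> EffEq C X"
    using clD(1) X \<Delta> by blast
  then obtain g where g: "g \<in> Arr C" "Dom C g = X" "cl X (?\<Delta> X) = kernel_pair C g"
    by (rule EffEq_cases)
  obtain e where e: "is_regular_epi C e" "Dom C e = Dom C g" "kernel_le C g e" "kernel_le C e g"
    using quotient_exists[OF g(1)] .
  have ea: "e \<in> Arr C"
    by (rule regular_epiD(1)[OF e(1)])
  have ker: "cl X (?\<Delta> X) = kernel_pair C e"
    using kernel_pair_eq_iff[OF g(1) ea] e g by simp
  let ?E = "Cod C e"
  have E: "?E \<in> Ob C"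
    using ea by simp
  have eh: "e \<in> hom C X ?E"
    using ea e(2) g(2) by (simp add: hom_iff)
  have "cl ?E (?\<Delta> ?E) \<in> EffEq C ?E"
    using clD(1) E \<Delta> by blast
  then obtain d where d: "d \<in> Arr C" "Dom C d = ?E" "cl ?E (?\<Delta> ?E) = kernel_pair C d"
    by (rule EffEq_cases)
  have "kernel_pair C (d \<cdot> e) = inv_image_rel C e (cl ?E (?\<Delta> ?E))"
    using inv_image_kernel_pair[OF ea d(1)] d by simp
  also have "\<dots> = cl X (inv_image_rel C e (?\<Delta> ?E))"
    using clD(5)[OF eh \<Delta>[OF E] e(1)] by simp
  also have "inv_image_rel C e (?\<Delta> ?E) = cl X (?\<Delta> X)"
    using inv_image_kernel_pair[OF ea, of "Idn C ?E"] ea E ker by simp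
  also have "cl X \<dots> = kernel_pair C e"
    using clD(4)[OF X \<Delta>[OF X]] ker by simp
  finally have "kernel_le C (d \<cdot> e) e"
    using kernel_pair_eq_iff[of "d \<cdot> e" e] ea d by simp
  then have "kernel_le C d (Idn C ?E)"
    using kernel_le_cancel[OF e(1) d(1,2), of "Idn C ?E"] ea E by simp
  then have "kernel_pair C d = ?\<Delta> ?E"
    using kernel_pair_eq_iff[OF d(1), of "Idn C ?E"] kernel_le_Idn[OF E d(1,2)] E d(2) by simp
  then have "?E \<in> closed_objects C cl"
    using E d(3) by (simp add: closed_objects_def)
  then show ?thesis
    using that e(1,2) g(2) ker by simp
qed

text \<open>Every effective equivalence relation is the inverse image of a diagonal along its quotient
  map, so by stability under regular epimorphisms its closure is determined by closures of
  diagonals, which are the kernel pairs of the reflections.\<close>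

lemma closure_is_reflection_closure:
  assumes cl: "cl \<in> effective_closure_operators C"
  shows "reflection_closure C (closed_objects C cl) = cl"
    and "\<And>g. g \<in> Arr C \<Longrightarrow> \<exists>r. is_quotient_reflection C (closed_objects C cl) g r"
proof -
  note clD = effective_closureD[OF cl]
  let ?B = "closed_objects C cl"
  have main: "\<exists>r. is_quotient_reflection C ?B g r \<and> cl (Dom C g) (kernel_pair C g) = kernel_pair C r"
    if g: "g \<in> Arr C" for g
  proof -
    obtain q where q: "is_regular_epi C q" "Dom C q = Dom C g" "kernel_le C g q" "kernel_le C q g"
      using quotient_exists[OF g] .
    have qa: "q \<in> Arr C"
      by (rule regular_epiD(1)[OF q(1)])
    let ?Q = "Cod C q"
    have Q: "?Q \<in> Ob C"
      using qa by simp
    obtain e where e: "is_regular_epi C e" "Dom C e = ?Q" "Cod C e \<in> ?B"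
      "cl ?Q (kernel_pair C (Idn C ?Q)) = kernel_pair C e"
      using closure_diagonal_quotient[OF cl Q] .
    have ea: "e \<in> Arr C"
      by (rule regular_epiD(1)[OF e(1)])
    have "is_quotient_reflection C ?B (Idn C ?Q) e"
      unfolding is_quotient_reflection_def
    proof (intro conjI ballI impI)
      fix h assume h: "h \<in> Arr C" "Dom C h = Dom C (Idn C ?Q) \<and> Cod C h \<in> ?B \<and> kernel_le C (Idn C ?Q) h"
      then have "kernel_le C e h"
        using closure_le_kernel_pair[OF cl _ h(1) _ _ _ ea, of "Idn C ?Q"] Q e(2,4) by simp
      then show "\<exists>k\<in>hom C (Cod C e) (Cod C h). k \<cdot> e = h"
        using regular_epi_factor[OF e(1) h(1)] h(2) e(2) Q by (metis idn_arr(2))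
    qed (use ea e Q kernel_le_Idn[OF Q ea e(2)] in simp_all)
    then have "is_quotient_reflection C ?B (Idn C ?Q \<cdot> q) (e \<cdot> q)"
      using quotient_reflection_precomp[OF _ _ q(1)] Q by simp
    then have refl: "is_quotient_reflection C ?B q (e \<cdot> q)"
      using qa by simp
    have refl': "is_quotient_reflection C ?B g (e \<cdot> q)"
      unfolding is_quotient_reflection_def
    proof (intro conjI ballI impI)
      note rD = quotient_reflectionD[OF refl]
      show "e \<cdot> q \<in> Arr C" "Dom C (e \<cdot> q) = Dom C g" "Cod C (e \<cdot> q) \<in> ?B"
        using rD q(2) by simp_all
      show "kernel_le C g (e \<cdot> q)"
        using kernel_le_trans[OF q(3) rD(4)] q(2) by simp
      fix h assume h: "h \<in> Arr C" "Dom C h = Dom C g \<and> Cod C h \<in> ?B \<and> kernel_le C g h"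
      have "kernel_le C q h"
        using kernel_le_trans[OF q(4)] q(2) h by simp
      then show "\<exists>k\<in>hom C (Cod C (e \<cdot> q)) (Cod C h). k \<cdot> (e \<cdot> q) = h"
        using quotient_reflection_factor[OF refl h(1)] h(2) q(2) by metis
    qed
    have "kernel_pair C g = inv_image_rel C q (kernel_pair C (Idn C ?Q))"
      using inv_image_kernel_pair[OF qa, of "Idn C ?Q"] kernel_pair_eq_iff[OF g qa] q qa Q by simp
    then have "cl (Dom C g) (kernel_pair C g) = inv_image_rel C q (kernel_pair C e)"
      using clD(5)[of q "Dom C g" ?Q "kernel_pair C (Idn C ?Q)"] kernel_pair_EffEq[of "Idn C ?Q" ?Q]
        q(1,2) qa Q e(4) by (simp add: hom_iff)
    then have "cl (Dom C g) (kernel_pair C g) = kernel_pair C (e \<cdot> q)"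
      using inv_image_kernel_pair[OF qa ea] e(2) by simp
    then show ?thesis
      using refl' by blast
  qed
  show refl: "\<exists>r. is_quotient_reflection C ?B g r" if "g \<in> Arr C" for g
    using main[OF that] by blast
  have rc: "reflection_closure C ?B \<in> (\<Pi>\<^sub>E X\<in>Ob C. EffEq C X \<rightarrow>\<^sub>E EffEq C X)"
    using effective_closureD(1)[OF reflection_closure_effective[OF refl]] .
  show "reflection_closure C ?B = cl"
  proof (rule PiE_ext[OF rc clD(1)])
    fix X assume X: "X \<in> Ob C"
    show "reflection_closure C ?B X = cl X"
    proof (rule PiE_ext[OF PiE_mem[OF rc X] PiE_mem[OF clD(1) X]])
      fix S assume "S \<in> EffEq C X"
      then obtain g where g: "g \<in> Arr C" "Dom C g = X" "S = kernel_pair C g"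
        by (rule EffEq_cases)
      then show "reflection_closure C ?B X S = cl X S"
        using main[OF g(1)] reflection_closure_kernel_pair[OF g(1)] by auto
    qed
  qed
qed

end

definition full_on :: "('o, 'a) category \<Rightarrow> 'o set \<Rightarrow> 'o set \<times> 'a set" where
  "full_on C B = (B, {f \<in> Arr C. Dom C f \<in> B \<and> Cod C f \<in> B})"

context regular_category
begin

lemma full_on_subcategory:
  assumes "B \<subseteq> Ob C"
  shows "is_subcategory C (full_on C B)"
proof -
  have "category (subcat C (full_on C B))"
    using assms by unfold_locales (auto simp: full_on_def hom_def)
  then show ?thesis
    using assms by (auto simp: is_subcategory_def full_on_def)
qed

text \<open>Universal arrows assemble to a left adjoint of the inclusion: the action of the reflector
  on arrows is induced by the universal property, and it is functorial because the unit
  consists of epimorphisms.\<close>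

lemma full_on_reflective:
  assumes B: "B \<subseteq> Ob C"
    and refl: "\<And>A. A \<in> Ob C \<Longrightarrow> \<exists>e. is_regular_epi C e \<and> Dom C e = A \<and> Cod C e \<in> B \<and>
      (\<forall>f\<in>Arr C. Dom C f = A \<and> Cod C f \<in> B \<longrightarrow> (\<exists>k\<in>hom C (Cod C e) (Cod C f). k \<cdot> e = f))"
  shows "\<exists>R \<eta>. is_left_adjoint C (subcat C (full_on C B)) R id_functor \<eta> \<and>
    (\<forall>A\<in>Ob C. is_regular_epi C (\<eta> A))"
proof -
  obtain \<eta> where \<eta>: "\<And>A. A \<in> Ob C \<Longrightarrow> is_regular_epi C (\<eta> A) \<and> Dom C (\<eta> A) = A \<and> Cod C (\<eta> A) \<in> B \<and>
      (\<forall>f\<in>Arr C. Dom C f = A \<and> Cod C f \<in> B \<longrightarrow> (\<exists>k\<in>hom C (Cod C (\<eta> A)) (Cod C f). k \<cdot> \<eta> A = f))"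
    using refl by metis
  have \<eta>a: "\<eta> A \<in> Arr C" "Dom C (\<eta> A) = A" "Cod C (\<eta> A) \<in> B" "Cod C (\<eta> A) \<in> Ob C" if "A \<in> Ob C" for A
    using \<eta>[OF that] regular_epiD(1) B by auto
  have univ: "\<exists>k\<in>hom C (Cod C (\<eta> A)) (Cod C f). k \<cdot> \<eta> A = f"
    if "A \<in> Ob C" "f \<in> Arr C" "Dom C f = A" "Cod C f \<in> B" for A f
    using \<eta>[OF that(1)] that by blast
  have cancel: "h = k"
    if "A \<in> Ob C" "h \<in> hom C (Cod C (\<eta> A)) D" "k \<in> hom C (Cod C (\<eta> A)) D" "h \<cdot> \<eta> A = k \<cdot> \<eta> A" for A h k D
    using regular_epiD(2)[of "\<eta> A"] \<eta>[OF that(1)] that by blast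
  define r where "r f = (SOME k. k \<in> hom C (Cod C (\<eta> (Dom C f))) (Cod C (\<eta> (Cod C f))) \<and>
    k \<cdot> \<eta> (Dom C f) = \<eta> (Cod C f) \<cdot> f)" for f
  have r: "r f \<in> hom C (Cod C (\<eta> (Dom C f))) (Cod C (\<eta> (Cod C f)))"
    "r f \<cdot> \<eta> (Dom C f) = \<eta> (Cod C f) \<cdot> f" if f: "f \<in> Arr C" for f
  proof -
    have "\<exists>k. k \<in> hom C (Cod C (\<eta> (Dom C f))) (Cod C (\<eta> (Cod C f))) \<and>
        k \<cdot> \<eta> (Dom C f) = \<eta> (Cod C f) \<cdot> f"
      using univ[of "Dom C f" "\<eta> (Cod C f) \<cdot> f"] f \<eta>a[of "Cod C f"] by auto
    from someI_ex[OF this]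
    show "r f \<in> hom C (Cod C (\<eta> (Dom C f))) (Cod C (\<eta> (Cod C f)))"
      "r f \<cdot> \<eta> (Dom C f) = \<eta> (Cod C f) \<cdot> f"
      unfolding r_def by auto
  qed
  have r_id: "r (Idn C A) = Idn C (Cod C (\<eta> A))" if A: "A \<in> Ob C" for A
  proof (rule cancel[OF A])
    show "r (Idn C A) \<in> hom C (Cod C (\<eta> A)) (Cod C (\<eta> A))"
      using r(1)[of "Idn C A"] A by simp
    show "Idn C (Cod C (\<eta> A)) \<in> hom C (Cod C (\<eta> A)) (Cod C (\<eta> A))"
      using \<eta>a[OF A] by (intro Idn_in_hom)
    show "r (Idn C A) \<cdot> \<eta> A = Idn C (Cod C (\<eta> A)) \<cdot> \<eta> A"
      using r(2)[of "Idn C A"] A \<eta>a[OF A] by simp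
  qed
  have r_comp: "r (g \<cdot> f) = r g \<cdot> r f" if f: "f \<in> Arr C" and g: "g \<in> Arr C" "Cod C f = Dom C g" for f g
  proof (rule cancel[of "Dom C f"])
    let ?A = "Dom C f" and ?B = "Dom C g" and ?D = "Cod C g"
    have ob: "?A \<in> Ob C" "?B \<in> Ob C" "?D \<in> Ob C"
      using f g by simp_all
    note \<eta>s = \<eta>a(1,2)[OF ob(1)] \<eta>a(1,2)[OF ob(2)] \<eta>a(1,2)[OF ob(3)]
    have rf: "r f \<in> Arr C" "Dom C (r f) = Cod C (\<eta> ?A)" "Cod C (r f) = Cod C (\<eta> ?B)"
      "r f \<cdot> \<eta> ?A = \<eta> ?B \<cdot> f"
      using r[OF f] g(2) by (simp_all add: hom_iff)
    have rg: "r g \<in> Arr C" "Dom C (r g) = Cod C (\<eta> ?B)" "Cod C (r g) = Cod C (\<eta> ?D)"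
      "r g \<cdot> \<eta> ?B = \<eta> ?D \<cdot> g"
      using r[OF g(1)] by (simp_all add: hom_iff)
    show "r (g \<cdot> f) \<in> hom C (Cod C (\<eta> ?A)) (Cod C (\<eta> ?D))"
      using r(1)[of "g \<cdot> f"] f g by simp
    show "r g \<cdot> r f \<in> hom C (Cod C (\<eta> ?A)) (Cod C (\<eta> ?D))"
      using rf(1-3) rg(1-3) by (simp add: hom_iff)
    have "(r g \<cdot> r f) \<cdot> \<eta> ?A = r g \<cdot> (r f \<cdot> \<eta> ?A)"
      using rf(1-3) rg(1-3) \<eta>s by simp
    also have "\<dots> = (r g \<cdot> \<eta> ?B) \<cdot> f"
      unfolding rf(4) using rg(1-3) \<eta>s f g by simp
    also have "\<dots> = \<eta> ?D \<cdot> (g \<cdot> f)"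
      unfolding rg(4) using \<eta>s f g by simp
    also have "\<dots> = r (g \<cdot> f) \<cdot> \<eta> ?A"
      using r(2)[of "g \<cdot> f"] f g by simp
    finally show "r (g \<cdot> f) \<cdot> \<eta> ?A = (r g \<cdot> r f) \<cdot> \<eta> ?A"
      by simp
    show "?A \<in> Ob C"
      by (rule ob)
  qed
  let ?D = "subcat C (full_on C B)"
  have homD: "hom ?D X Y = (if X \<in> B \<and> Y \<in> B then hom C X Y else {})" for X Y
    by (auto simp: hom_iff full_on_def)
  have obD: "Ob ?D = B"
    by (simp add: full_on_def)
  define R where "R = \<lparr>on_ob = \<lambda>A. Cod C (\<eta> A), on_arr = r\<rparr>"
  have Rs: "on_ob R A = Cod C (\<eta> A)" "on_arr R f = r f" for A f
    by (simp_all add: R_def)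
  have "is_functor C ?D R"
    unfolding is_functor_def Rs obD homD subcat_simps(5,6)
    using \<eta>a(3) r_id r_comp r(1) by (auto simp: hom_iff)
  moreover have "is_functor ?D C id_functor"
    unfolding is_functor_def obD homD using B by (auto simp: id_functor_def)
  moreover have "is_nat_trans C C id_functor (comp_functor id_functor R) \<eta>"
    unfolding is_nat_trans_def using \<eta>a r(2) by (auto simp: id_functor_def comp_functor_def Rs hom_iff)
  moreover let ?I = "id_functor :: ('a, 'b, 'a, 'b) fnctr"
  have "\<exists>!g. g \<in> hom ?D (on_ob R A) D \<and> on_arr ?I g \<cdot> \<eta> A = f"
    if A: "A \<in> Ob C" and D: "D \<in> Ob ?D" and f: "f \<in> hom C A (on_ob ?I D)" for A D f
  proof -
    have D': "D \<in> B" and f': "f \<in> Arr C" "Dom C f = A" "Cod C f = D"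
      using D[unfolded obD] f by (auto simp: id_functor_def hom_iff)
    have "\<exists>k\<in>hom C (Cod C (\<eta> A)) D. k \<cdot> \<eta> A = f"
      using univ[OF A f'(1,2)] D' f'(3) by simp
    then have "\<exists>!g. g \<in> hom C (Cod C (\<eta> A)) D \<and> g \<cdot> \<eta> A = f"
      using cancel[OF A] by blast
    then show ?thesis
      using \<eta>a(3)[OF A] D' by (simp add: homD Rs id_functor_def)
  qed
  ultimately have "is_left_adjoint C ?D R id_functor \<eta>"
    unfolding is_left_adjoint_def by (intro conjI ballI)
  then show ?thesis
    using \<eta> by blast
qed

text \<open>Closed objects are closed under subobjects, in particular under isomorphism: the diagonal of
  the domain of a monomorphism is the inverse image of the diagonal of its codomain.\<close>

lemma closed_objects_subobject:
  assumes cl: "cl \<in> effective_closure_operators C"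
    and m: "is_mono C m" "Cod C m \<in> closed_objects C cl"
  shows "Dom C m \<in> closed_objects C cl"
proof -
  let ?X = "Dom C m"
  have ma: "m \<in> Arr C" and X: "?X \<in> Ob C"
    using m(1) by (auto simp: is_mono_def)
  obtain e where e: "is_regular_epi C e" "Dom C e = ?X"
    "cl ?X (kernel_pair C (Idn C ?X)) = kernel_pair C e"
    using closure_diagonal_quotient[OF cl X] by metis
  have ea: "e \<in> Arr C"
    by (rule regular_epiD(1)[OF e(1)])
  have "kernel_le C e m"
    using closure_le_kernel_pair[OF cl _ ma _ m(2) _ ea, of "Idn C ?X"] X e kernel_le_Idn[OF X ma] by simp
  moreover have "kernel_le C m (Idn C ?X)"
  proof (rule kernel_leI)
    fix A u v assume "A \<in> Ob C" "u \<in> hom C A ?X" "v \<in> hom C A ?X" "m \<cdot> u = m \<cdot> v"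
    then have "u = v"
      using m(1) unfolding is_mono_def by blast
    then show "Idn C ?X \<cdot> u = Idn C ?X \<cdot> v"
      by simp
  qed
  ultimately have "kernel_le C e (Idn C ?X)"
    using kernel_le_trans e(2) by blast
  then have "kernel_pair C e = kernel_pair C (Idn C ?X)"
    using kernel_pair_eq_iff[OF ea, of "Idn C ?X"] kernel_le_Idn[OF X ea e(2)] e(2) X by simp
  then show ?thesis
    using X e(3) by (simp add: closed_objects_def)
qed

lemma full_on_closed_objects_epireflective:
  assumes cl: "cl \<in> effective_closure_operators C"
  shows "full_on C (closed_objects C cl) \<in> epireflective_subcategories C"
proof -
  let ?B = "closed_objects C cl"
  have B: "?B \<subseteq> Ob C"
    by (auto simp: closed_objects_def)
  have "is_full C (full_on C ?B)"
    by (auto simp: is_full_def full_on_def hom_iff)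
  moreover have "is_replete C (full_on C ?B)"
    unfolding is_replete_def
  proof (intro allI impI)
    fix f assume f: "is_iso C f \<and> Dom C f \<in> fst (full_on C ?B)"
    then obtain g where fg: "f \<in> Arr C" "g \<in> hom C (Cod C f) (Dom C f)" "f \<cdot> g = Idn C (Cod C f)"
      by (auto simp: is_iso_def)
    have ga: "g \<in> Arr C" "Dom C g = Cod C f" "Cod C g = Dom C f"
      using fg(2) by (simp_all add: hom_iff)
    have "is_mono C g"
      unfolding is_mono_def
    proof (intro conjI ballI impI ga(1))
      fix A u v assume uv: "u \<in> hom C A (Dom C g)" "v \<in> hom C A (Dom C g)" "g \<cdot> u = g \<cdot> v"
      have "(f \<cdot> g) \<cdot> u = (f \<cdot> g) \<cdot> v"
        using uv fg(1) ga by (simp add: hom_iff)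
      then show "u = v"
        using uv(1,2) ga(2) fg(3) by (simp add: hom_iff)
    qed
    then have "Cod C f \<in> ?B"
      using closed_objects_subobject[OF cl] f ga by (metis full_on_def fst_conv)
    then show "Cod C f \<in> fst (full_on C ?B) \<and> f \<in> snd (full_on C ?B)"
      using f fg(1) by (simp add: full_on_def)
  qed
  moreover have "\<exists>R \<eta>. is_left_adjoint C (subcat C (full_on C ?B)) R id_functor \<eta> \<and>
    (\<forall>A\<in>Ob C. is_regular_epi C (\<eta> A))"
  proof (rule full_on_reflective[OF B])
    fix A assume A: "A \<in> Ob C"
    obtain e where e: "is_regular_epi C e" "Dom C e = A" "Cod C e \<in> ?B"
      "cl A (kernel_pair C (Idn C A)) = kernel_pair C e"
      using closure_diagonal_quotient[OF cl A] .
    have ea: "e \<in> Arr C"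
      by (rule regular_epiD(1)[OF e(1)])
    have "\<exists>k\<in>hom C (Cod C e) (Cod C f). k \<cdot> e = f"
      if f: "f \<in> Arr C" "Dom C f = A" "Cod C f \<in> ?B" for f
    proof -
      have "kernel_le C e f"
        using closure_le_kernel_pair[OF cl _ f(1) _ f(3) _ ea, of "Idn C A"] A e f(2)
          kernel_le_Idn[OF A f(1,2)] by simp
      then show ?thesis
        using regular_epi_factor[OF e(1) f(1)] f(2) e(2) by metis
    qed
    then show "\<exists>e. is_regular_epi C e \<and> Dom C e = A \<and> Cod C e \<in> ?B \<and>
      (\<forall>f\<in>Arr C. Dom C f = A \<and> Cod C f \<in> ?B \<longrightarrow> (\<exists>k\<in>hom C (Cod C e) (Cod C f). k \<cdot> e = f))"
      using e by blast
  qed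
  ultimately show ?thesis
    using full_on_subcategory[OF B] by (simp add: epireflective_subcategories_def)
qed

end

section \<open>The correspondence\<close>

theorem theorem2p3:
  fixes C :: "('o, 'a) category"
  assumes "category C" and "finitely_complete C" and "regular C"
  shows "\<exists>\<Phi>. bij_betw \<Phi> (epireflective_subcategories C) (effective_closure_operators C)"
proof -
  interpret regular_category C
    using assms by (simp add: regular_category_def regular_category_axioms_def)
  have "bij_betw (\<lambda>L. reflection_closure C (fst L))
    (epireflective_subcategories C) (effective_closure_operators C)"
  proof (rule bij_betw_byWitness[where f' = "\<lambda>cl. full_on C (closed_objects C cl)"])
    show "\<forall>L\<in>epireflective_subcategories C.
        full_on C (closed_objects C (reflection_closure C (fst L))) = L"
    proof
      fix L assume L: "L \<in> epireflective_subcategories C"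
      have "full_on C (fst L) = L"
        using epireflective_arrows(2)[OF L] by (simp add: full_on_def prod_eq_iff)
      then show "full_on C (closed_objects C (reflection_closure C (fst L))) = L"
        by (simp only: closed_objects_reflection_closure[OF L])
    qed
    show "\<forall>cl\<in>effective_closure_operators C.
        reflection_closure C (fst (full_on C (closed_objects C cl))) = cl"
      using closure_is_reflection_closure(1) by (simp add: full_on_def)
    show "(\<lambda>L. reflection_closure C (fst L)) ` epireflective_subcategories C
        \<subseteq> effective_closure_operators C"
      using reflection_closure_effective epireflective_quotient_reflection by blast
    show "(\<lambda>cl. full_on C (closed_objects C cl)) ` effective_closure_operators C
        \<subseteq> epireflective_subcategories C"
      using full_on_closed_objects_epireflective by blast
  qed
  then show ?thesis
    by blast
qed

end
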